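(* Let $f\colon\Gamma\to\Delta$ be a covering of connected profinite graphs, let $p\colon\widetilde\Delta\to\Delta$ be the universal covering map, and let $G=\operatorname{Aut}(\widetilde\Delta,p)$. Then there is a closed subgroup $H$ of $G$ such that $\Gamma$ is isomorphic, as a profinite graph, to $\widetilde\Delta/H$.
   Context: A graph $\Gamma$ is a set that is the disjoint union of a set $V(\Gamma)$ of vertices and a set $E(\Gamma)$ of edges, with maps $s,t\colon E(\Gamma)\to V(\Gamma)$ and an involution $e\mapsto\overline e$ of $E(\Gamma)$ such that $\overline e\ne e$, $s(\overline e)=t(e)$, $t(\overline e)=s(e)$. A map of graphs sends vertices to vertices and edges to edges and commutes with $s$, $t$ and $e\mapsto\overline e$. It is locally bijective if for every vertex $v$ it restricts to a bijection from $\{e\mid s(e)=v\}$ onto $\{e'\mid s(e')=f(v)\}$. A graph is path connected if it is nonempty and any two vertices are joined by a finite edge path. An equivalence relation $R$ on a graph $\Gamma$ is compatible if no vertex is equivalent to an edge, if $(e_1,e_2)\in R$ for edges implies $(s(e_1),s(e_2)),(t(e_1),t(e_2)),(\overline{e_1},\overline{e_2})\in R$, and $(e,\overline e)\notin R$ for all edges $e$; thus the set $\Gamma/R$ of classes is a graph. A cofinite graph is a graph with a Hausdorff uniformity in which every entourage contains a compatible cofinite entourage, i.e. an entourage that is a compatible equivalence relation with finitely many classes. A profinite graph is a compact cofinite graph (equivalently, an inverse limit of finite discrete graphs). It is connected if $\Gamma/R$ is path connected for every compatible cofinite entourage $R$. An inverse system of maps $(f_i\colon\Gamma_i\to\Delta_i,\phi_{ij},\psi_{ij})$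 over a directed set $I$ consists of continuous maps of graphs $f_i$, and, for $j\ge i$, continuous maps of graphs $\phi_{ij}\colon\Gamma_j\to\Gamma_i$, $\psi_{ij}\colon\Delta_j\to\Delta_i$ forming inverse systems, with $f_i\phi_{ij}=\psi_{ij}f_j$. Its inverse limit is the induced continuous map $f\colon\varprojlim\Gamma_i\to\varprojlim\Delta_i$. A map of profinite graphs $f\colon\Gamma\to\Delta$ is a covering if it is the inverse limit of an inverse system of locally bijective maps of finite discrete graphs; then $(\Gamma,f)$ is called a profinite covering graph of $\Delta$, connected if $\Gamma$ is connected. A homomorphism from a profinite covering graph $(\Gamma_1,f_1)$ of $\Delta$ to another $(\Gamma_2,f_2)$ is a continuous map of graphs $h\colon\Gamma_1\to\Gamma_2$ with $f_2h=f_1$. For $\Delta$ connected, a connected profinite covering graph $(\widetilde\Delta,p)$ of $\Delta$ is the universal profinite covering graph of $\Delta$ (and $p$ the universal covering; it exists and is unique up to isomorphism) if, whenever $(\Gamma,f)$ is a connected profinite covering graph of $\Delta$ and $c$, $a$ are vertices of $\widetilde\Delta$, $\Gamma$ with $p(c)=f(a)$, there exists a homomorphism of coverings $h$ from $(\widetilde\Delta,p)$ to $(\Gamma,f)$ with $h(c)=a$. $G=\operatorname{Aut}(\widetilde\Delta,p)$ is the group of continuous maps of graphs $\alpha\colon\widetilde\Delta\to\widetilde\Delta$ with continuous inverse and $p\alpha=p$. It carries the group topology induced by its action: a base of neighbourhoods of $1$ is given by the finite-index normal subgroups $N_R=\{g\in G\mid (gx,x)\in R\ \forall x\in\widetilde\Delta\}$,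 where $R$ runs over the $G$-invariant compatible cofinite entourages of $\widetilde\Delta$ (those with $(g\times g)[R]=R$ for all $g$). $\widetilde\Delta/H$ is the orbit graph with the quotient topology. *)

theory Defs
  imports "HOL-Analysis.Analysis" "HOL-Algebra.Coset"
begin

subsection \<open>Graphs\<close>

text \<open>Only the values of the structure maps on the edge set matter.\<close>

record 'a graph =
  verts :: "'a set"
  edges :: "'a set"
  src :: "'a \<Rightarrow> 'a"
  tgt :: "'a \<Rightarrow> 'a"
  rev_edge :: "'a \<Rightarrow> 'a"

definition points :: "('a, 'm) graph_scheme \<Rightarrow> 'a set"
  where "points G = verts G \<union> edges G"

definition is_graph :: "('a, 'm) graph_scheme \<Rightarrow> bool"
  where "is_graph G \<longleftrightarrow>
    verts G \<inter> edges G = {} \<and>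
    (\<forall>e\<in>edges G. src G e \<in> verts G \<and> tgt G e \<in> verts G \<and> rev_edge G e \<in> edges G \<and>
       rev_edge G (rev_edge G e) = e \<and> rev_edge G e \<noteq> e \<and>
       src G (rev_edge G e) = tgt G e \<and> tgt G (rev_edge G e) = src G e)"

definition graph_map :: "('a, 'm) graph_scheme \<Rightarrow> ('b, 'n) graph_scheme \<Rightarrow> ('a \<Rightarrow> 'b) \<Rightarrow> bool"
  where "graph_map G D f \<longleftrightarrow>
    f ` verts G \<subseteq> verts D \<and> f ` edges G \<subseteq> edges D \<and>
    (\<forall>e\<in>edges G. f (src G e) = src D (f e) \<and> f (tgt G e) = tgt D (f e) \<and>
       f (rev_edge G e) = rev_edge D (f e))"

definition star :: "('a, 'm) graph_scheme \<Rightarrow> 'a \<Rightarrow> 'a set"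
  where "star G v = {e \<in> edges G. src G e = v}"

definition locally_bijective ::
    "('a, 'm) graph_scheme \<Rightarrow> ('b, 'n) graph_scheme \<Rightarrow> ('a \<Rightarrow> 'b) \<Rightarrow> bool"
  where "locally_bijective G D f \<longleftrightarrow> (\<forall>v\<in>verts G. bij_betw f (star G v) (star D (f v)))"

definition path_connected_graph :: "('a, 'm) graph_scheme \<Rightarrow> bool"
  where "path_connected_graph G \<longleftrightarrow>
    points G \<noteq> {} \<and>
    (\<forall>u\<in>verts G. \<forall>v\<in>verts G. (u, v) \<in> {(src G e, tgt G e) | e. e \<in> edges G}\<^sup>*)"


subsection \<open>Compatible equivalence relations and quotient graphs\<close>

definition compatible_equiv :: "('a, 'm) graph_scheme \<Rightarrow> ('a \<times> 'a) set \<Rightarrow> bool"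
  where "compatible_equiv G R \<longleftrightarrow>
    equiv (points G) R \<and>
    (\<forall>v\<in>verts G. \<forall>e\<in>edges G. (v, e) \<notin> R) \<and>
    (\<forall>e1\<in>edges G. \<forall>e2\<in>edges G. (e1, e2) \<in> R \<longrightarrow>
       (src G e1, src G e2) \<in> R \<and> (tgt G e1, tgt G e2) \<in> R \<and>
       (rev_edge G e1, rev_edge G e2) \<in> R) \<and>
    (\<forall>e\<in>edges G. (e, rev_edge G e) \<notin> R)"

text \<open>The source of a class \<open>C\<close> of edges is the class that contains the sources of all members
  of \<open>C\<close>; likewise for targets and reversal.\<close>

definition quotient_graph :: "('a, 'm) graph_scheme \<Rightarrow> ('a \<times> 'a) set \<Rightarrow> 'a set graph"
  where "quotient_graph G R =
    \<lparr>verts = verts G // R, edges = edges G // R,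
     src = (\<lambda>C. R `` (src G ` C)), tgt = (\<lambda>C. R `` (tgt G ` C)),
     rev_edge = (\<lambda>C. R `` (rev_edge G ` C))\<rparr>"


subsection \<open>Cofinite and profinite graphs\<close>

text \<open>Uniformities on a carrier set, as systems of entourages; the uniformities of the library are
  bound to a type class and always live on a whole type.\<close>

record 'a ugraph = "'a graph" +
  entourages :: "('a \<times> 'a) set set"

definition uniformity_on :: "'a set \<Rightarrow> ('a \<times> 'a) set set \<Rightarrow> bool"
  where "uniformity_on X \<U> \<longleftrightarrow>
    \<U> \<noteq> {} \<and>
    (\<forall>W\<in>\<U>. Id_on X \<subseteq> W \<and> W \<subseteq> X \<times> X) \<and>
    (\<forall>W\<in>\<U>. \<forall>W'. W \<subseteq> W' \<and> W' \<subseteq> X \<times> X \<longrightarrow> W' \<in> \<U>) \<and>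
    (\<forall>W\<in>\<U>. \<forall>W'\<in>\<U>. W \<inter> W' \<in> \<U>) \<and>
    (\<forall>W\<in>\<U>. W\<inverse> \<in> \<U>) \<and>
    (\<forall>W\<in>\<U>. \<exists>W'\<in>\<U>. W' O W' \<subseteq> W)"

definition uniform_topology :: "'a set \<Rightarrow> ('a \<times> 'a) set set \<Rightarrow> 'a topology"
  where "uniform_topology X \<U> =
    topology (\<lambda>S. S \<subseteq> X \<and> (\<forall>x\<in>S. \<exists>W\<in>\<U>. W `` {x} \<subseteq> S))"

lemma uniformity_on_Int:
  assumes "uniformity_on X \<U>" "W \<in> \<U>" "W' \<in> \<U>"
  shows "W \<inter> W' \<in> \<U>"
proof -
  have "\<forall>W\<in>\<U>. \<forall>W'\<in>\<U>. W \<inter> W' \<in> \<U>"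
    using assms(1) unfolding uniformity_on_def by (elim conjE)
  then show ?thesis using assms(2,3) by blast
qed

lemma uniformity_on_subset:
  assumes "uniformity_on X \<U>" "W \<in> \<U>"
  shows "W \<subseteq> X \<times> X"
proof -
  have "\<forall>W\<in>\<U>. Id_on X \<subseteq> W \<and> W \<subseteq> X \<times> X"
    using assms(1) unfolding uniformity_on_def by (elim conjE)
  then show ?thesis using assms(2) by blast
qed

lemma openin_uniform_topology:
  assumes "uniformity_on X \<U>"
  shows "openin (uniform_topology X \<U>) S \<longleftrightarrow> S \<subseteq> X \<and> (\<forall>x\<in>S. \<exists>W\<in>\<U>. W `` {x} \<subseteq> S)"
proof -
  have "istopology (\<lambda>S. S \<subseteq> X \<and> (\<forall>x\<in>S. \<exists>W\<in>\<U>. W `` {x} \<subseteq> S))"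
    unfolding istopology_def
  proof (intro conjI allI impI ballI)
    fix S T x
    assume S: "S \<subseteq> X \<and> (\<forall>x\<in>S. \<exists>W\<in>\<U>. W `` {x} \<subseteq> S)"
      and T: "T \<subseteq> X \<and> (\<forall>x\<in>T. \<exists>W\<in>\<U>. W `` {x} \<subseteq> T)" and x: "x \<in> S \<inter> T"
    from S x obtain W where W: "W \<in> \<U>" "W `` {x} \<subseteq> S" by auto
    from T x obtain W' where W': "W' \<in> \<U>" "W' `` {x} \<subseteq> T" by auto
    show "\<exists>W\<in>\<U>. W `` {x} \<subseteq> S \<inter> T"
      using W(2) W'(2) by (intro bexI[OF _ uniformity_on_Int[OF assms W(1) W'(1)]]) blast
  next
    fix \<K> x
    assume *: "\<forall>S\<in>\<K>. S \<subseteq> X \<and> (\<forall>x\<in>S. \<exists>W\<in>\<U>. W `` {x} \<subseteq> S)" and "x \<in> \<Union>\<K>"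
    then obtain S where S: "S \<in> \<K>" "x \<in> S" by auto
    with * obtain W where W: "W \<in> \<U>" "W `` {x} \<subseteq> S" by blast
    show "\<exists>W\<in>\<U>. W `` {x} \<subseteq> \<Union>\<K>"
      using W(2) S(1) by (intro bexI[OF _ W(1)]) auto
  qed auto
  then show ?thesis
    unfolding uniform_topology_def by (simp add: topology_inverse')
qed

lemma topspace_uniform_topology:
  assumes "uniformity_on X \<U>"
  shows "topspace (uniform_topology X \<U>) = X"
proof
  show "topspace (uniform_topology X \<U>) \<subseteq> X"
    using openin_topspace[of "uniform_topology X \<U>"]
    unfolding openin_uniform_topology[OF assms] by (rule conjunct1)
  have "\<U> \<noteq> {}"
    using assms unfolding uniformity_on_def by (elim conjE)
  then obtain W where "W \<in> \<U>" by blast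
  moreover from this have "W \<subseteq> X \<times> X" by (rule uniformity_on_subset[OF assms])
  ultimately have "openin (uniform_topology X \<U>) X"
    by (auto simp: openin_uniform_topology[OF assms])
  then show "X \<subseteq> topspace (uniform_topology X \<U>)"
    by (rule openin_subset)
qed

abbreviation graph_topology :: "('a, 'm) ugraph_scheme \<Rightarrow> 'a topology"
  where "graph_topology G \<equiv> uniform_topology (points G) (entourages G)"

definition compatible_cofinite_entourage :: "('a, 'm) ugraph_scheme \<Rightarrow> ('a \<times> 'a) set \<Rightarrow> bool"
  where "compatible_cofinite_entourage G R \<longleftrightarrow>
    R \<in> entourages G \<and> compatible_equiv G R \<and> finite (points G // R)"

definition cofinite_graph :: "('a, 'm) ugraph_scheme \<Rightarrow> bool"
  where "cofinite_graph G \<longleftrightarrow>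
    is_graph G \<and> uniformity_on (points G) (entourages G) \<and> Hausdorff_space (graph_topology G) \<and>
    (\<forall>W\<in>entourages G. \<exists>R. compatible_cofinite_entourage G R \<and> R \<subseteq> W)"

definition profinite_graph :: "('a, 'm) ugraph_scheme \<Rightarrow> bool"
  where "profinite_graph G \<longleftrightarrow> cofinite_graph G \<and> compact_space (graph_topology G)"

definition connected_profinite_graph :: "('a, 'm) ugraph_scheme \<Rightarrow> bool"
  where "connected_profinite_graph G \<longleftrightarrow>
    profinite_graph G \<and>
    (\<forall>R. compatible_cofinite_entourage G R \<longrightarrow> path_connected_graph (quotient_graph G R))"

definition cont_graph_map ::
    "('a, 'm) ugraph_scheme \<Rightarrow> ('b, 'n) ugraph_scheme \<Rightarrow> ('a \<Rightarrow> 'b) \<Rightarrow> bool"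
  where "cont_graph_map G D f \<longleftrightarrow>
    graph_map G D f \<and> continuous_map (graph_topology G) (graph_topology D) f"

text \<open>The inverse of a bijective map of graphs is a map of graphs, so a map of graphs that is a
  homeomorphism is an isomorphism.\<close>

definition profinite_graph_iso ::
    "('a, 'm) ugraph_scheme \<Rightarrow> ('b, 'n) ugraph_scheme \<Rightarrow> ('a \<Rightarrow> 'b) \<Rightarrow> bool"
  where "profinite_graph_iso G D f \<longleftrightarrow>
    profinite_graph G \<and> profinite_graph D \<and>
    graph_map G D f \<and> homeomorphic_map (graph_topology G) (graph_topology D) f"


subsection \<open>Inverse limits of finite discrete graphs\<close>

definition directed_on :: "'i set \<Rightarrow> ('i \<Rightarrow> 'i \<Rightarrow> bool) \<Rightarrow> bool"
  where "directed_on I rel \<longleftrightarrow>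
    I \<noteq> {} \<and> (\<forall>i\<in>I. rel i i) \<and>
    (\<forall>i\<in>I. \<forall>j\<in>I. \<forall>k\<in>I. rel i j \<and> rel j k \<longrightarrow> rel i k) \<and>
    (\<forall>i\<in>I. \<forall>j\<in>I. \<exists>k\<in>I. rel i k \<and> rel j k)"

text \<open>\<open>\<phi> i j\<close> is the transition map from the graph at \<open>j\<close> to the graph at \<open>i\<close>. Finite graphs carry
  the discrete topology, so that all maps between them are continuous.\<close>

definition inverse_system ::
    "'i set \<Rightarrow> ('i \<Rightarrow> 'i \<Rightarrow> bool) \<Rightarrow> ('i \<Rightarrow> 'x graph) \<Rightarrow> ('i \<Rightarrow> 'i \<Rightarrow> 'x \<Rightarrow> 'x) \<Rightarrow> bool"
  where "inverse_system I rel G \<phi> \<longleftrightarrow>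
    directed_on I rel \<and>
    (\<forall>i\<in>I. is_graph (G i) \<and> finite (points (G i))) \<and>
    (\<forall>i\<in>I. \<forall>j\<in>I. rel i j \<longrightarrow> graph_map (G j) (G i) (\<phi> i j)) \<and>
    (\<forall>i\<in>I. \<forall>x\<in>points (G i). \<phi> i i x = x) \<and>
    (\<forall>i\<in>I. \<forall>j\<in>I. \<forall>k\<in>I. rel i j \<and> rel j k \<longrightarrow>
       (\<forall>x\<in>points (G k). \<phi> i j (\<phi> j k x) = \<phi> i k x))"

definition threads ::
    "'i set \<Rightarrow> ('i \<Rightarrow> 'i \<Rightarrow> bool) \<Rightarrow> ('i \<Rightarrow> 'i \<Rightarrow> 'x \<Rightarrow> 'x) \<Rightarrow> ('i \<Rightarrow> 'x set) \<Rightarrow> ('i \<Rightarrow> 'x) set"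
  where "threads I rel \<phi> A =
    {x \<in> Pi\<^sub>E I A. \<forall>i\<in>I. \<forall>j\<in>I. rel i j \<longrightarrow> \<phi> i j (x j) = x i}"

definition limit_graph ::
    "'i set \<Rightarrow> ('i \<Rightarrow> 'i \<Rightarrow> bool) \<Rightarrow> ('i \<Rightarrow> 'x graph) \<Rightarrow> ('i \<Rightarrow> 'i \<Rightarrow> 'x \<Rightarrow> 'x) \<Rightarrow> ('i \<Rightarrow> 'x) graph"
  where "limit_graph I rel G \<phi> =
    \<lparr>verts = threads I rel \<phi> (\<lambda>i. verts (G i)), edges = threads I rel \<phi> (\<lambda>i. edges (G i)),
     src = (\<lambda>x. \<lambda>i\<in>I. src (G i) (x i)), tgt = (\<lambda>x. \<lambda>i\<in>I. tgt (G i) (x i)),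
     rev_edge = (\<lambda>x. \<lambda>i\<in>I. rev_edge (G i) (x i))\<rparr>"

definition limit_topology ::
    "'i set \<Rightarrow> ('i \<Rightarrow> 'i \<Rightarrow> bool) \<Rightarrow> ('i \<Rightarrow> 'x graph) \<Rightarrow> ('i \<Rightarrow> 'i \<Rightarrow> 'x \<Rightarrow> 'x) \<Rightarrow> ('i \<Rightarrow> 'x) topology"
  where "limit_topology I rel G \<phi> =
    subtopology (product_topology (\<lambda>i. discrete_topology (points (G i))) I)
      (points (limit_graph I rel G \<phi>))"

text \<open>Identification of a profinite graph with the inverse limit of a system of finite graphs.\<close>

definition limit_iso ::
    "('a, 'm) ugraph_scheme \<Rightarrow> 'i set \<Rightarrow> ('i \<Rightarrow> 'i \<Rightarrow> bool) \<Rightarrow> ('i \<Rightarrow> 'x graph) \<Rightarrow>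
     ('i \<Rightarrow> 'i \<Rightarrow> 'x \<Rightarrow> 'x) \<Rightarrow> ('a \<Rightarrow> 'i \<Rightarrow> 'x) \<Rightarrow> bool"
  where "limit_iso \<Gamma> I rel G \<phi> a \<longleftrightarrow>
    graph_map \<Gamma> (limit_graph I rel G \<phi>) a \<and>
    homeomorphic_map (graph_topology \<Gamma>) (limit_topology I rel G \<phi>) a"


subsection \<open>Coverings\<close>

text \<open>\<open>f\<close> is, up to the identifications \<open>a\<close> and \<open>b\<close>, the limit of the locally bijective maps \<open>F i\<close>.
  Every finite graph has a copy on natural numbers. An inverse system on a directed set of
  arbitrary size can be restricted to a directed subset indexed by the type \<open>nat + 'a + 'b\<close> with
  the same limit map: choose indices that separate the points of \<open>\<Gamma>\<close> and of \<open>\<Delta>\<close>, and close under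
  upper bounds of pairs and under passing from \<open>i\<close> to some \<open>j \<ge> i\<close> such that the images of \<open>G j\<close>
  in \<open>G i\<close> and of \<open>D j\<close> in \<open>D i\<close> are the images of the limits. Hence the two type choices below are
  no restriction.\<close>

definition covering ::
    "('a, 'm) ugraph_scheme \<Rightarrow> ('b, 'n) ugraph_scheme \<Rightarrow> ('a \<Rightarrow> 'b) \<Rightarrow> bool"
  where "covering \<Gamma> \<Delta> f \<longleftrightarrow>
    profinite_graph \<Gamma> \<and> profinite_graph \<Delta> \<and> cont_graph_map \<Gamma> \<Delta> f \<and>
    (\<exists>(I :: (nat + 'a + 'b) set) rel (G :: _ \<Rightarrow> nat graph) (D :: _ \<Rightarrow> nat graph) \<phi> \<psi> F a b.
       inverse_system I rel G \<phi> \<and> inverse_system I rel D \<psi> \<and>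
       (\<forall>i\<in>I. graph_map (G i) (D i) (F i) \<and> locally_bijective (G i) (D i) (F i)) \<and>
       (\<forall>i\<in>I. \<forall>j\<in>I. rel i j \<longrightarrow>
          (\<forall>x\<in>points (G j). F i (\<phi> i j x) = \<psi> i j (F j x))) \<and>
       limit_iso \<Gamma> I rel G \<phi> a \<and> limit_iso \<Delta> I rel D \<psi> b \<and>
       (\<forall>x\<in>points \<Gamma>. b (f x) = (\<lambda>i\<in>I. F i (a x i))))"

definition connected_covering ::
    "('a, 'm) ugraph_scheme \<Rightarrow> ('b, 'n) ugraph_scheme \<Rightarrow> ('a \<Rightarrow> 'b) \<Rightarrow> bool"
  where "connected_covering \<Gamma> \<Delta> f \<longleftrightarrow> covering \<Gamma> \<Delta> f \<and> connected_profinite_graph \<Gamma>"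

definition covering_hom ::
    "('a, 'm) ugraph_scheme \<Rightarrow> ('a \<Rightarrow> 'c) \<Rightarrow> ('b, 'n) ugraph_scheme \<Rightarrow> ('b \<Rightarrow> 'c) \<Rightarrow> ('a \<Rightarrow> 'b) \<Rightarrow> bool"
  where "covering_hom \<Gamma>\<^sub>1 f\<^sub>1 \<Gamma>\<^sub>2 f\<^sub>2 h \<longleftrightarrow>
    cont_graph_map \<Gamma>\<^sub>1 \<Gamma>\<^sub>2 h \<and> (\<forall>x\<in>points \<Gamma>\<^sub>1. f\<^sub>2 (h x) = f\<^sub>1 x)"

text \<open>HOL cannot quantify over types inside a formula, so the type \<open>'u\<close> of the covering graphs over
  which the universal property ranges is a parameter. The universal profinite covering graph has
  this property for every \<open>'u\<close>.\<close>

definition universal_covering ::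
    "'u itself \<Rightarrow> ('a, 'm) ugraph_scheme \<Rightarrow> ('b, 'n) ugraph_scheme \<Rightarrow> ('a \<Rightarrow> 'b) \<Rightarrow> bool"
  where "universal_covering U \<Delta>\<^sub>u \<Delta> p \<longleftrightarrow>
    connected_profinite_graph \<Delta> \<and> connected_covering \<Delta>\<^sub>u \<Delta> p \<and>
    (\<forall>(\<Gamma> :: 'u ugraph) f c a.
       connected_covering \<Gamma> \<Delta> f \<and> c \<in> verts \<Delta>\<^sub>u \<and> a \<in> verts \<Gamma> \<and> p c = f a \<longrightarrow>
       (\<exists>h. covering_hom \<Delta>\<^sub>u p \<Gamma> f h \<and> h c = a))"


subsection \<open>The automorphism group of a covering graph\<close>

text \<open>Automorphisms are represented by functions that are \<open>undefined\<close> outside the graph, so that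
  equality in the group is equality on the graph.\<close>

definition covering_aut :: "('a, 'm) ugraph_scheme \<Rightarrow> ('a \<Rightarrow> 'b) \<Rightarrow> ('a \<Rightarrow> 'a) monoid"
  where "covering_aut \<Gamma> p =
    \<lparr>carrier = {\<alpha> \<in> extensional (points \<Gamma>).
        graph_map \<Gamma> \<Gamma> \<alpha> \<and> homeomorphic_map (graph_topology \<Gamma>) (graph_topology \<Gamma>) \<alpha> \<and>
        (\<forall>x\<in>points \<Gamma>. p (\<alpha> x) = p x)},
     mult = (\<lambda>\<alpha> \<beta>. compose (points \<Gamma>) \<alpha> \<beta>),
     one = (\<lambda>x\<in>points \<Gamma>. x)\<rparr>"

definition invariant_entourage :: "('a, 'm) ugraph_scheme \<Rightarrow> ('a \<Rightarrow> 'b) \<Rightarrow> ('a \<times> 'a) set \<Rightarrow> bool"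
  where "invariant_entourage \<Gamma> p R \<longleftrightarrow>
    compatible_cofinite_entourage \<Gamma> R \<and>
    (\<forall>g\<in>carrier (covering_aut \<Gamma> p). map_prod g g ` R = R)"

definition aut_nbhd :: "('a, 'm) ugraph_scheme \<Rightarrow> ('a \<Rightarrow> 'b) \<Rightarrow> ('a \<times> 'a) set \<Rightarrow> ('a \<Rightarrow> 'a) set"
  where "aut_nbhd \<Gamma> p R = {g \<in> carrier (covering_aut \<Gamma> p). \<forall>x\<in>points \<Gamma>. (g x, x) \<in> R}"

definition aut_topology :: "('a, 'm) ugraph_scheme \<Rightarrow> ('a \<Rightarrow> 'b) \<Rightarrow> ('a \<Rightarrow> 'a) topology"
  where "aut_topology \<Gamma> p = topology (\<lambda>S. S \<subseteq> carrier (covering_aut \<Gamma> p) \<and>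
    (\<forall>g\<in>S. \<exists>R. invariant_entourage \<Gamma> p R \<and> g <#\<^bsub>covering_aut \<Gamma> p\<^esub> aut_nbhd \<Gamma> p R \<subseteq> S))"

lemma finite_quotient_Int:
  assumes "equiv X R" "equiv X S" "finite (X // R)" "finite (X // S)"
  shows "finite (X // (R \<inter> S))"
proof (rule finite_subset)
  show "X // (R \<inter> S) \<subseteq> (\<lambda>(A, B). A \<inter> B) ` ((X // R) \<times> (X // S))"
  proof
    fix C assume "C \<in> X // (R \<inter> S)"
    then obtain x where x: "x \<in> X" "C = (R \<inter> S) `` {x}" by (rule quotientE)
    then have "C = R `` {x} \<inter> S `` {x}" by blast
    with x show "C \<in> (\<lambda>(A, B). A \<inter> B) ` ((X // R) \<times> (X // S))"
      by (auto intro: quotientI)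
  qed
  show "finite ((\<lambda>(A, B). A \<inter> B) ` ((X // R) \<times> (X // S)))"
    using assms by simp
qed

lemma equiv_Int:
  assumes "equiv X R" "equiv X S"
  shows "equiv X (R \<inter> S)"
  using assms by (auto simp: equiv_def refl_on_def intro: sym_Int trans_Int)

lemma invariant_entourage_Int:
  assumes G: "uniformity_on (points \<Gamma>) (entourages \<Gamma>)"
    and R: "invariant_entourage \<Gamma> p R" and S: "invariant_entourage \<Gamma> p S"
  shows "invariant_entourage \<Gamma> p (R \<inter> S)"
proof -
  have eq: "equiv (points \<Gamma>) R" "equiv (points \<Gamma>) S"
    and comp: "compatible_equiv \<Gamma> R" "compatible_equiv \<Gamma> S"
    and fin: "finite (points \<Gamma> // R)" "finite (points \<Gamma> // S)"
    and ent: "R \<in> entourages \<Gamma>" "S \<in> entourages \<Gamma>"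
    using R S by (simp_all add: invariant_entourage_def compatible_cofinite_entourage_def
      compatible_equiv_def)
  have "compatible_equiv \<Gamma> (R \<inter> S)"
    using comp equiv_Int[OF eq] by (simp add: compatible_equiv_def)
  moreover have "R \<inter> S \<in> entourages \<Gamma>"
    using G ent by (rule uniformity_on_Int)
  moreover have "map_prod g g ` (R \<inter> S) = R \<inter> S" if g: "g \<in> carrier (covering_aut \<Gamma> p)" for g
  proof -
    have "inj_on g (points \<Gamma>)"
      using g homeomorphic_imp_injective_map[of "graph_topology \<Gamma>" "graph_topology \<Gamma>" g]
      by (simp add: covering_aut_def topspace_uniform_topology[OF G])
    then have "inj_on (map_prod g g) (points \<Gamma> \<times> points \<Gamma>)"
      by (auto simp: inj_on_def)
    moreover have "R \<subseteq> points \<Gamma> \<times> points \<Gamma>" "S \<subseteq> points \<Gamma> \<times> points \<Gamma>"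
      using G ent by (simp_all add: uniformity_on_subset)
    ultimately have "map_prod g g ` (R \<inter> S) = map_prod g g ` R \<inter> map_prod g g ` S"
      by (rule inj_on_image_Int)
    then show ?thesis
      using R S g unfolding invariant_entourage_def by simp
  qed
  ultimately show ?thesis
    using finite_quotient_Int[OF eq fin]
    by (simp add: invariant_entourage_def compatible_cofinite_entourage_def)
qed

lemma openin_aut_topology:
  assumes "uniformity_on (points \<Gamma>) (entourages \<Gamma>)"
  shows "openin (aut_topology \<Gamma> p) S \<longleftrightarrow> S \<subseteq> carrier (covering_aut \<Gamma> p) \<and>
    (\<forall>g\<in>S. \<exists>R. invariant_entourage \<Gamma> p R \<and> g <#\<^bsub>covering_aut \<Gamma> p\<^esub> aut_nbhd \<Gamma> p R \<subseteq> S)"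
proof -
  let ?P = "\<lambda>g R S. invariant_entourage \<Gamma> p R \<and>
    g <#\<^bsub>covering_aut \<Gamma> p\<^esub> aut_nbhd \<Gamma> p R \<subseteq> S"
  have Int: "?P g (R \<inter> Q) (S \<inter> T)" if "?P g R S" "?P g Q T" for g R Q S T
  proof
    show "invariant_entourage \<Gamma> p (R \<inter> Q)"
      using that by (intro invariant_entourage_Int[OF assms]) auto
    show "g <#\<^bsub>covering_aut \<Gamma> p\<^esub> aut_nbhd \<Gamma> p (R \<inter> Q) \<subseteq> S \<inter> T"
      using that unfolding l_coset_def aut_nbhd_def by fast
  qed
  have "istopology (\<lambda>S. S \<subseteq> carrier (covering_aut \<Gamma> p) \<and> (\<forall>g\<in>S. \<exists>R. ?P g R S))"
    unfolding istopology_def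
  proof (intro conjI allI impI ballI)
    fix S T g
    assume S: "S \<subseteq> carrier (covering_aut \<Gamma> p) \<and> (\<forall>g\<in>S. \<exists>R. ?P g R S)"
      and T: "T \<subseteq> carrier (covering_aut \<Gamma> p) \<and> (\<forall>g\<in>T. \<exists>R. ?P g R T)"
      and g: "g \<in> S \<inter> T"
    from S g obtain R where R: "?P g R S" by auto
    from T g obtain Q where Q: "?P g Q T" by auto
    show "\<exists>R. ?P g R (S \<inter> T)"
      by (rule exI, rule Int[OF R Q])
  next
    fix \<K> g
    assume *: "\<forall>S\<in>\<K>. S \<subseteq> carrier (covering_aut \<Gamma> p) \<and> (\<forall>g\<in>S. \<exists>R. ?P g R S)"
      and "g \<in> \<Union>\<K>"
    then obtain S where S: "S \<in> \<K>" "g \<in> S" by auto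
    with * obtain R where R: "?P g R S" by blast
    show "\<exists>R. ?P g R (\<Union>\<K>)"
      using R S(1) by (intro exI[of _ R]) auto
  qed auto
  then show ?thesis
    unfolding aut_topology_def by (simp add: topology_inverse')
qed


subsection \<open>Orbit graphs\<close>

definition orbit_of :: "('a \<Rightarrow> 'a) set \<Rightarrow> 'a \<Rightarrow> 'a set"
  where "orbit_of H x = {h x | h. h \<in> H}"

text \<open>The sources of the edges in one orbit form an orbit of vertices.\<close>

definition orbit_graph :: "('a, 'm) graph_scheme \<Rightarrow> ('a \<Rightarrow> 'a) set \<Rightarrow> 'a set graph"
  where "orbit_graph \<Gamma> H =
    \<lparr>verts = orbit_of H ` verts \<Gamma>, edges = orbit_of H ` edges \<Gamma>,
     src = image (src \<Gamma>), tgt = image (tgt \<Gamma>), rev_edge = image (rev_edge \<Gamma>)\<rparr>"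

text \<open>The orbit graph with the quotient topology, as a profinite graph; its uniformity is determined
  by its topology, which is compact and Hausdorff.\<close>

definition is_profinite_orbit_graph ::
    "('a, 'm) ugraph_scheme \<Rightarrow> ('a \<Rightarrow> 'a) set \<Rightarrow> 'a set ugraph \<Rightarrow> bool"
  where "is_profinite_orbit_graph \<Gamma> H Q \<longleftrightarrow>
    graph.truncate Q = orbit_graph \<Gamma> H \<and> profinite_graph Q \<and>
    quotient_map (graph_topology \<Gamma>) (graph_topology Q) (orbit_of H)"

end

theory Submission
  imports Defs
begin

text \<open>Lifts of \<open>p\<close> along \<open>f\<close> are unique once the image of a vertex is given, because two lifts agree on
  a clopen set that is closed under passing along edges. The universal property applied to
  \<open>\<Delta>\<^sub>u\<close> itself therefore shows that \<open>G\<close> acts transitively on the fibres of \<open>p\<close>, so that \<open>p\<close> is open.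
  Applied to \<open>\<Gamma>\<close> it gives a lift \<open>h : \<Delta>\<^sub>u \<rightarrow> \<Gamma>\<close>. Since \<open>p\<close> is open and \<open>\<Gamma>\<close> is connected, the
  image of \<open>h\<close> meets every fibre of every coordinate map of \<open>\<Gamma>\<close> over \<open>\<Delta>\<close>, and \<open>h\<close> is surjective by
  compactness. With \<open>H = {g \<in> G. h \<circ> g = h}\<close> the fibres of \<open>h\<close> are the \<open>H\<close>-orbits.\<close>

subsection \<open>Locally constant maps and compactness\<close>

text \<open>The obstacle is that a connected profinite graph need not contain a path between two
  given vertices, so nothing can be lifted or compared along paths from a base point. Connectedness
  is visible only in finite quotients, and every path argument becomes an induction over a clopen
  set. Clopen sets come from the finite levels, where coordinates are locally constant. Statements
  are therefore proved level by level and passed to the limit, either because coordinates separate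
  points or by compactness. This is where openness of \<open>p\<close> enters. The set used for
  surjectivity of \<open>h\<close> asks for a point of \<open>\<Delta>\<^sub>u\<close> over
  \<open>f y\<close> with a prescribed coordinate under \<open>h\<close>, and so involves the image
  under \<open>p\<close> of a clopen set. Compactness makes that image closed; that it is open comes
  from the transitive action on fibres. Neighbourhoods in \<open>G\<close> come from invariant
  entourages, so closedness of \<open>H\<close> requires constructing such entourages that are fine
  enough to control the coordinates of \<open>h\<close>. The orbit graph gets its uniformity from
  \<Gamma>: its points are the fibres of \<open>h\<close>, to which the structure of \<Gamma> is
  carried over.\<close>

lemma clopen_locally_constant:
  assumes "continuous_map T (discrete_topology UNIV) u" "continuous_map T (discrete_topology UNIV) v"
  shows "openin T {x \<in> topspace T. P (u x) (v x)}" "closedin T {x \<in> topspace T. P (u x) (v x)}"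
proof -
  \<comment> \<open>A product of two discrete spaces is discrete, so every set of pairs is clopen
    and \<open>P\<close> can be arbitrary.\<close>
  have uv: "continuous_map T (discrete_topology UNIV) (\<lambda>x. (u x, v x))"
    using continuous_map_pairedI[OF assms]
    by (simp only: UNIV_Times_UNIV flip: prod_topology_discrete_topology)
  show "openin T {x \<in> topspace T. P (u x) (v x)}"
    using openin_continuous_map_preimage[OF uv, of "{(s, t). P s t}"] by simp
  show "closedin T {x \<in> topspace T. P (u x) (v x)}"
    using closedin_continuous_map_preimage[OF uv, of "{(s, t). P s t}"] by simp
qed

lemma clopen_locally_constant1:
  assumes "continuous_map T (discrete_topology UNIV) u"
  shows "openin T {x \<in> topspace T. P (u x)}" "closedin T {x \<in> topspace T. P (u x)}"
  using clopen_locally_constant[OF assms assms, of "\<lambda>s t. P s"] by auto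

lemma continuous_map_into_discrete_UNIV:
  assumes "continuous_map T (discrete_topology A) u"
  shows "continuous_map T (discrete_topology UNIV) u"
  using assms by (metis continuous_map_in_subtopology inf_top_left subtopology_discrete_topology)

text \<open>Directedness puts a single member of the family inside any finite intersection, so the
  finite intersection property reduces to nonemptiness of the members. This is the passage from all
  finite levels to the limit.\<close>

lemma compact_space_directed_Inter:
  assumes T: "compact_space T" and I: "directed_on I rel"
    and closed: "\<And>i. i \<in> I \<Longrightarrow> closedin T (C i)"
    and ne: "\<And>i. i \<in> I \<Longrightarrow> C i \<noteq> {}"
    and mono: "\<And>i j. i \<in> I \<Longrightarrow> j \<in> I \<Longrightarrow> rel i j \<Longrightarrow> C j \<subseteq> C i"
  obtains x where "x \<in> topspace T" "\<And>i. i \<in> I \<Longrightarrow> x \<in> C i"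
proof -
  have dir: "\<exists>k\<in>I. \<forall>i\<in>J. C k \<subseteq> C i" if "finite J" "J \<subseteq> I" for J
    using that
  proof (induction J rule: finite_induct)
    case empty
    then show ?case using I unfolding directed_on_def by blast
  next
    case (insert j J)
    then obtain k where k: "k \<in> I" "\<forall>i\<in>J. C k \<subseteq> C i" by auto
    obtain l where "l \<in> I" "rel j l" "rel k l"
      using I k(1) insert.prems unfolding directed_on_def by (meson insert_subset)
    with mono[of j l] mono[of k l] k insert.prems show ?case by blast
  qed
  have "\<Inter>\<F> \<noteq> {}" if F: "finite \<F>" "\<F> \<subseteq> C ` I" for \<F>
  proof -
    obtain J where J: "finite J" "J \<subseteq> I" "\<F> = C ` J"
      using F finite_subset_image by metis
    with dir obtain k where "k \<in> I" "\<forall>i\<in>J. C k \<subseteq> C i" by metis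
    then have "C k \<subseteq> \<Inter>\<F>" using J(3) by blast
    with ne[OF \<open>k \<in> I\<close>] show ?thesis by blast
  qed
  with T closed have "\<Inter>(C ` I) \<noteq> {}"
    unfolding compact_space_fip by (metis imageE)
  then obtain x where x: "\<And>i. i \<in> I \<Longrightarrow> x \<in> C i" by auto
  moreover obtain i where "i \<in> I" using I unfolding directed_on_def by blast
  ultimately have "x \<in> topspace T"
    using closedin_subset[OF closed] by blast
  with x show thesis using that by blast
qed

text \<open>Tychonoff: the threads up to level \<open>j\<close> form a nonempty closed subset of the product.\<close>

lemma threads_nonempty:
  assumes I: "directed_on I rel"
    and fin: "\<And>i. i \<in> I \<Longrightarrow> finite (A i)" and ne: "\<And>i. i \<in> I \<Longrightarrow> A i \<noteq> {}"
    and maps: "\<And>i j x. i \<in> I \<Longrightarrow> j \<in> I \<Longrightarrow> rel i j \<Longrightarrow> x \<in> A j \<Longrightarrow> \<phi> i j x \<in> A i"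
    and id: "\<And>i x. i \<in> I \<Longrightarrow> x \<in> A i \<Longrightarrow> \<phi> i i x = x"
    and comp: "\<And>i j k x. i \<in> I \<Longrightarrow> j \<in> I \<Longrightarrow> k \<in> I \<Longrightarrow> rel i j \<Longrightarrow> rel j k \<Longrightarrow> x \<in> A k \<Longrightarrow>
      \<phi> i j (\<phi> j k x) = \<phi> i k x"
  shows "threads I rel \<phi> A \<noteq> {}"
proof -
  define T where "T = product_topology (\<lambda>i. discrete_topology (A i)) I"
  define C where "C j = {x \<in> topspace T. \<forall>i\<in>I. rel i j \<longrightarrow> \<phi> i j (x j) = x i}" for j
  have T: "topspace T = Pi\<^sub>E I A" by (simp add: T_def)
  have cont: "continuous_map T (discrete_topology UNIV) (\<lambda>x. x i)" if "i \<in> I" for i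
    unfolding T_def
    by (rule continuous_map_into_discrete_UNIV, rule continuous_map_product_projection[OF that])
  have trans: "\<And>i j k. i \<in> I \<Longrightarrow> j \<in> I \<Longrightarrow> k \<in> I \<Longrightarrow> rel i j \<Longrightarrow> rel j k \<Longrightarrow> rel i k"
    using I unfolding directed_on_def by blast
  have compact: "compact_space T"
    using fin by (simp add: T_def compact_space_product_topology compact_space_discrete_topology)
  have closed: "closedin T (C j)" if "j \<in> I" for j
  proof -
    have "closedin T {x \<in> topspace T. \<phi> i j (x j) = x i}" if "i \<in> I" for i
      using clopen_locally_constant(2)[OF cont[OF \<open>j \<in> I\<close>] cont[OF that]] .
    moreover have "rel j j" using I \<open>j \<in> I\<close> unfolding directed_on_def by blast
    ultimately have "closedin T (topspace T \<inter> (\<Inter>i\<in>{i\<in>I. rel i j}. {x \<in> topspace T. \<phi> i j (x j) = x i}))"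
      using that by (intro closedin_Int closedin_Inter) auto
    moreover have "C j = topspace T \<inter> (\<Inter>i\<in>{i\<in>I. rel i j}. {x \<in> topspace T. \<phi> i j (x j) = x i})"
      by (auto simp: C_def)
    ultimately show ?thesis by simp
  qed
  have nonempty: "C j \<noteq> {}" if j: "j \<in> I" for j
  proof -
    obtain w where w: "w \<in> A j" using ne[OF j] by blast
    \<comment> \<open>Only the coordinates below \<open>j\<close> are constrained by
      \<open>C j\<close>, and they are forced by \<open>w\<close>; the others are filled
      arbitrarily.\<close>
    define x where "x = (\<lambda>i\<in>I. if rel i j then \<phi> i j w else SOME y. y \<in> A i)"
    have "rel j j" using I j unfolding directed_on_def by blast
    then have "x j = w" using id[OF j w] j by (simp add: x_def)
    moreover have "x \<in> Pi\<^sub>E I A"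
      using maps[OF _ j _ w] someI_ex[of "\<lambda>y. y \<in> A _"] ne unfolding x_def
      by (intro restrict_PiE_iff[THEN iffD2] ballI) (simp add: some_in_eq)
    ultimately have "x \<in> C j" by (auto simp: C_def T x_def)
    then show ?thesis by blast
  qed
  have mono: "C k \<subseteq> C j" if "j \<in> I" "k \<in> I" "rel j k" for j k
  proof
    fix x assume x: "x \<in> C k"
    have "\<phi> i j (x j) = x i" if i: "i \<in> I" "rel i j" for i
    proof -
      have "x k \<in> A k" using x \<open>k \<in> I\<close> by (auto simp: C_def T)
      then show ?thesis
        using x that \<open>j \<in> I\<close> \<open>k \<in> I\<close> \<open>rel j k\<close> comp[of i j k "x k"] trans[of i j k]
        by (auto simp: C_def)
    qed
    then show "x \<in> C j" using x by (auto simp: C_def)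
  qed
  obtain x where "x \<in> topspace T" "\<forall>i\<in>I. x \<in> C i"
  proof (rule compact_space_directed_Inter[where C = C, OF compact I closed nonempty mono])
    fix x assume "x \<in> topspace T" "\<And>i. i \<in> I \<Longrightarrow> x \<in> C i"
    then show thesis using that by blast
  qed
  then have "x \<in> threads I rel \<phi> A"
    by (auto simp: threads_def T C_def)
  then show ?thesis by blast
qed


subsection \<open>Graph maps\<close>

lemma graph_src: "is_graph G \<Longrightarrow> e \<in> edges G \<Longrightarrow> src G e \<in> verts G"
  and graph_tgt: "is_graph G \<Longrightarrow> e \<in> edges G \<Longrightarrow> tgt G e \<in> verts G"
  and graph_rev: "is_graph G \<Longrightarrow> e \<in> edges G \<Longrightarrow> rev_edge G e \<in> edges G"
  and graph_src_rev: "is_graph G \<Longrightarrow> e \<in> edges G \<Longrightarrow> src G (rev_edge G e) = tgt G e"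
  and graph_rev_neq: "is_graph G \<Longrightarrow> e \<in> edges G \<Longrightarrow> rev_edge G e \<noteq> e"
  and graph_disjoint: "is_graph G \<Longrightarrow> v \<in> verts G \<Longrightarrow> v \<in> edges G \<Longrightarrow> False"
  unfolding is_graph_def by blast+

lemma graph_map_verts: "graph_map G D f \<Longrightarrow> v \<in> verts G \<Longrightarrow> f v \<in> verts D"
  and graph_map_edges: "graph_map G D f \<Longrightarrow> e \<in> edges G \<Longrightarrow> f e \<in> edges D"
  and graph_map_src: "graph_map G D f \<Longrightarrow> e \<in> edges G \<Longrightarrow> f (src G e) = src D (f e)"
  and graph_map_tgt: "graph_map G D f \<Longrightarrow> e \<in> edges G \<Longrightarrow> f (tgt G e) = tgt D (f e)"
  and graph_map_rev: "graph_map G D f \<Longrightarrow> e \<in> edges G \<Longrightarrow> f (rev_edge G e) = rev_edge D (f e)"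
  unfolding graph_map_def by auto

lemma graph_map_points: "graph_map G D f \<Longrightarrow> x \<in> points G \<Longrightarrow> f x \<in> points D"
  unfolding graph_map_def points_def by auto

text \<open>A point that is not a vertex is an edge, and its image would be a vertex and an edge at
  once.\<close>

lemma graph_map_reflects_verts:
  "graph_map G D f \<Longrightarrow> is_graph D \<Longrightarrow> x \<in> points G \<Longrightarrow> f x \<in> verts D \<Longrightarrow> x \<in> verts G"
  unfolding points_def by (metis Un_iff graph_disjoint graph_map_edges)

lemma graph_map_reflects_edges:
  "graph_map G D f \<Longrightarrow> is_graph D \<Longrightarrow> x \<in> points G \<Longrightarrow> f x \<in> edges D \<Longrightarrow> x \<in> edges G"
  unfolding points_def by (metis Un_iff graph_disjoint graph_map_verts)

lemma graph_map_compose: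
  assumes "graph_map G D f" "graph_map D E g"
  shows "graph_map G E (g \<circ> f)"
  using assms by (auto simp: graph_map_def image_subset_iff)

text \<open>Meant for automorphisms, which are cut off outside the graph. That the source graph
  satisfies the axioms guarantees that sources, targets and reversals of edges are points, where the
  two maps agree.\<close>

lemma graph_map_cong:
  assumes "is_graph G" "graph_map G D f" "\<And>x. x \<in> points G \<Longrightarrow> f x = g x"
  shows "graph_map G D g"
  using assms(2,3) graph_src[OF assms(1)] graph_tgt[OF assms(1)] graph_rev[OF assms(1)]
  unfolding graph_map_def image_subset_iff points_def by (metis UnCI)

text \<open>The inverse keeps vertices and edges apart because \<open>f\<close> reflects both. It
  commutes with the structure maps by applying \<open>g\<close> to the corresponding equations of
  \<open>f\<close> at \<open>g y\<close>.\<close>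

lemma graph_map_inverse:
  assumes G: "is_graph G" and D: "is_graph D" and f: "graph_map G D f"
    and g: "\<And>y. y \<in> points D \<Longrightarrow> g y \<in> points G \<and> f (g y) = y"
    and gf: "\<And>x. x \<in> points G \<Longrightarrow> g (f x) = x"
  shows "graph_map D G g"
proof -
  have gv: "g y \<in> verts G" if "y \<in> verts D" for y
    using graph_map_reflects_verts[OF f D, of "g y"] g[of y] that by (auto simp: points_def)
  have ge: "g y \<in> edges G" if "y \<in> edges D" for y
    using graph_map_reflects_edges[OF f D, of "g y"] g[of y] that by (auto simp: points_def)
  have "g (src D y) = src G (g y) \<and> g (tgt D y) = tgt G (g y) \<and> g (rev_edge D y) = rev_edge G (g y)"
    if y: "y \<in> edges D" for y
  proof -
    have e: "g y \<in> edges G" "f (g y) = y" using ge[OF y] g[of y] y by (auto simp: points_def)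
    then have "src G (g y) \<in> points G" "tgt G (g y) \<in> points G" "rev_edge G (g y) \<in> points G"
      using G by (auto simp: points_def graph_src graph_tgt graph_rev)
    then show ?thesis
      using gf graph_map_src[OF f e(1)] graph_map_tgt[OF f e(1)] graph_map_rev[OF f e(1)] e(2)
      by metis
  qed
  with gv ge show ?thesis by (auto simp: graph_map_def)
qed

lemma locally_bijective_lift:
  assumes "locally_bijective G D f" "v \<in> verts G" "e \<in> edges D" "src D e = f v"
  obtains e' where "e' \<in> edges G" "src G e' = v" "f e' = e"
proof -
  have "e \<in> f ` star G v"
    using assms by (auto simp: locally_bijective_def bij_betw_def star_def)
  then show thesis using that by (auto simp: star_def)
qed

lemma locally_bijective_inj:
  assumes "locally_bijective G D f" "is_graph G" "e \<in> edges G" "e' \<in> edges G"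
    "src G e = src G e'" "f e = f e'"
  shows "e = e'"
proof -
  have "inj_on f (star G (src G e))"
    using assms by (auto simp: locally_bijective_def bij_betw_def graph_src)
  then show ?thesis using assms by (auto simp: star_def inj_on_def)
qed


subsection \<open>Profinite graphs\<close>

lemma profinite_is_graph: "profinite_graph X \<Longrightarrow> is_graph X"
  and profinite_uniformity: "profinite_graph X \<Longrightarrow> uniformity_on (points X) (entourages X)"
  and profinite_Hausdorff: "profinite_graph X \<Longrightarrow> Hausdorff_space (graph_topology X)"
  and profinite_compact: "profinite_graph X \<Longrightarrow> compact_space (graph_topology X)"
  unfolding profinite_graph_def cofinite_graph_def by blast+

lemma cont_graph_map_compose:
  assumes "cont_graph_map X Y f" "cont_graph_map Y Z g"
  shows "cont_graph_map X Z (g \<circ> f)"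
  using assms graph_map_compose[of X Y f Z g]
    continuous_map_compose[of "graph_topology X" "graph_topology Y" f "graph_topology Z" g]
  by (simp add: cont_graph_map_def)

lemma cont_graph_map_id: "cont_graph_map X X (\<lambda>x. x)"
  by (simp add: cont_graph_map_def graph_map_def)

lemma profinite_topspace: "profinite_graph X \<Longrightarrow> topspace (graph_topology X) = points X"
  by (simp add: topspace_uniform_topology profinite_uniformity)

lemma profinite_small_entourage:
  assumes "profinite_graph X" "W \<in> entourages X"
  obtains R where "compatible_cofinite_entourage X R" "R \<subseteq> W"
  using assms unfolding profinite_graph_def cofinite_graph_def by blast

section \<open>Entourages from locally constant maps\<close>

lemma finite_Inter_entourages:
  assumes U: "uniformity_on X \<U>" and "finite \<R>" "\<R> \<noteq> {}" "\<R> \<subseteq> \<U>"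
  shows "\<Inter>\<R> \<in> \<U>"
  using assms(2-) by (induction \<R> rule: finite_ne_induct) (auto intro: uniformity_on_Int[OF U])

lemma uniformity_on_superset:
  assumes U: "uniformity_on X \<U>" and "W \<in> \<U>" "W \<subseteq> W'" "W' \<subseteq> X \<times> X"
  shows "W' \<in> \<U>"
proof -
  have "\<forall>W\<in>\<U>. \<forall>W'. W \<subseteq> W' \<and> W' \<subseteq> X \<times> X \<longrightarrow> W' \<in> \<U>"
    using U unfolding uniformity_on_def by (elim conjE)
  with assms show ?thesis by blast
qed

text \<open>Compactness makes a locally constant map uniformly locally constant. Equivalence
  relations take the place of the usual halving of entourages: if \<open>y\<close> lies in the class
  of \<open>x\<close> and \<open>z\<close> is related to \<open>y\<close>, then \<open>z\<close>
  lies in the same class, on which \<open>u\<close> is constant.\<close>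

lemma kernel_entourage:
  assumes X: "profinite_graph X"
    and u: "continuous_map (graph_topology X) (discrete_topology UNIV) u"
  shows "{(x, y) \<in> points X \<times> points X. u x = u y} \<in> entourages X"
proof (cases "points X = {}")
  \<comment> \<open>The empty graph is treated apart because the intersection formed below must run
    over a nonempty finite family.\<close>
  case True
  have "entourages X \<noteq> {}" "\<forall>W\<in>entourages X. W \<subseteq> points X \<times> points X"
    using profinite_uniformity[OF X] unfolding uniformity_on_def by blast+
  with True show ?thesis by auto
next
  case False
  note U = profinite_uniformity[OF X] and top = profinite_topspace[OF X]
  have "\<exists>R. compatible_cofinite_entourage X R \<and> R `` {x} \<subseteq> {y \<in> points X. u y = u x}"
    if x: "x \<in> points X" for x
  proof -
    have "openin (graph_topology X) {y \<in> points X. u y = u x}"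
      using clopen_locally_constant1(1)[OF u, of "\<lambda>t. t = u x"] by (simp add: top)
    with x obtain W where W: "W \<in> entourages X" "W `` {x} \<subseteq> {y \<in> points X. u y = u x}"
      unfolding openin_uniform_topology[OF U] by blast
    obtain R where "compatible_cofinite_entourage X R" "R \<subseteq> W"
      using profinite_small_entourage[OF X W(1)] .
    with W(2) show ?thesis by blast
  qed
  then obtain R where R: "\<And>x. x \<in> points X \<Longrightarrow> compatible_cofinite_entourage X (R x)"
    and Ru: "\<And>x. x \<in> points X \<Longrightarrow> R x `` {x} \<subseteq> {y \<in> points X. u y = u x}"
    by metis
  have equiv: "equiv (points X) (R x)" and ent: "R x \<in> entourages X" if "x \<in> points X" for x
    using R[OF that] by (auto simp: compatible_cofinite_entourage_def compatible_equiv_def)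
  \<comment> \<open>A class of an equivalence relation that is an entourage is open, since it is
    also the class of each of its points.\<close>
  have opens: "openin (graph_topology X) (R x `` {x})" if x: "x \<in> points X" for x
    unfolding openin_uniform_topology[OF U]
  proof (intro conjI ballI)
    show "R x `` {x} \<subseteq> points X" using Ru[OF x] by blast
    fix y assume "y \<in> R x `` {x}"
    then show "\<exists>W\<in>entourages X. W `` {y} \<subseteq> R x `` {x}"
      using ent[OF x] equiv_class_eq[OF equiv[OF x]] by (metis Image_singleton_iff order_refl)
  qed
  have cover: "points X \<subseteq> \<Union>((\<lambda>x. R x `` {x}) ` points X)"
    using equiv_class_self[OF equiv] by blast
  have "compactin (graph_topology X) (points X)"
    using profinite_compact[OF X] by (simp add: compact_space_def top)
  then have "\<exists>\<F>. finite \<F> \<and> \<F> \<subseteq> (\<lambda>x. R x `` {x}) ` points X \<and> points X \<subseteq> \<Union>\<F>"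
    by (rule compactinD[OF _ _ cover]) (auto simp only: opens image_iff)
  then obtain \<F> where "finite \<F>" "\<F> \<subseteq> (\<lambda>x. R x `` {x}) ` points X" "points X \<subseteq> \<Union>\<F>"
    by (elim exE conjE)
  then obtain J where J: "finite J" "J \<subseteq> points X" "points X \<subseteq> (\<Union>x\<in>J. R x `` {x})"
    using finite_subset_image[of \<F>] by (metis (no_types, lifting))
  have "J \<noteq> {}" using J False by auto
  have Inter: "\<Inter>(R ` J) \<in> entourages X"
    using J ent \<open>J \<noteq> {}\<close> by (intro finite_Inter_entourages[OF U]) auto
  have sub: "\<Inter>(R ` J) \<subseteq> {(x, y) \<in> points X \<times> points X. u x = u y}"
  proof clarsimp
    fix y z assume yz: "\<forall>x\<in>J. (y, z) \<in> R x"
    obtain x0 where "x0 \<in> J" using \<open>J \<noteq> {}\<close> by blast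
    then have pts: "y \<in> points X" "z \<in> points X"
      using yz J(2) uniformity_on_subset[OF U ent] by blast+
    then obtain x where x: "x \<in> J" "y \<in> R x `` {x}" using J(3) by blast
    then have "x \<in> points X" using J(2) by blast
    have "trans (R x)" using equiv[OF \<open>x \<in> points X\<close>] by (rule equivE)
    moreover have "(x, y) \<in> R x" "(y, z) \<in> R x" using x yz by blast+
    ultimately have "z \<in> R x `` {x}" by (blast elim: transE)
    with x(2) have "u y = u x" "u z = u x" using Ru[OF \<open>x \<in> points X\<close>] by blast+
    with pts show "y \<in> points X \<and> z \<in> points X \<and> u y = u z" by (simp only:)
  qed
  show ?thesis
    using Inter sub by (rule uniformity_on_superset[OF U]) (simp add: subset_iff)
qed

lemma kernel_equiv: "equiv A {(x, y) \<in> A \<times> A. u x = u y}"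
  by (rule equivI) (auto intro!: refl_onI symI transI)

lemma finite_quotient_kernel:
  assumes "finite (u ` A)"
  shows "finite (A // {(x, y) \<in> A \<times> A. u x = u y})"
proof (rule finite_subset)
  show "A // {(x, y) \<in> A \<times> A. u x = u y} \<subseteq> (\<lambda>t. {y \<in> A. u y = t}) ` (u ` A)"
  proof
    fix C assume "C \<in> A // {(x, y) \<in> A \<times> A. u x = u y}"
    then obtain x where "x \<in> A" "C = {(x, y) \<in> A \<times> A. u x = u y} `` {x}" by (rule quotientE)
    then have "x \<in> A" "C = {y \<in> A. u y = u x}" by auto
    then show "C \<in> (\<lambda>t. {y \<in> A. u y = t}) ` (u ` A)" by blast
  qed
  show "finite ((\<lambda>t. {y \<in> A. u y = t}) ` (u ` A))" using assms by simp
qed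

section \<open>Connectedness as induction over clopen sets\<close>

text \<open>The substitute for following a path. The indicator of \<open>S\<close> is locally
  constant, so \<open>S\<close> is a union of classes of some compatible cofinite \<open>R\<close>.
  A path joins the classes of \<open>c\<close> and \<open>v\<close> in the finite quotient; upstairs
  it is a chain of edges with jumps inside classes between them, and \<open>S\<close> absorbs these
  jumps.\<close>

lemma connected_profinite_clopen_induct:
  assumes X: "connected_profinite_graph X"
    and clopen: "openin (graph_topology X) S" "closedin (graph_topology X) S"
    and c: "c \<in> verts X" "c \<in> S"
    and step: "\<And>e. e \<in> edges X \<Longrightarrow> src X e \<in> S \<Longrightarrow> tgt X e \<in> S"
    and v: "v \<in> verts X"
  shows "v \<in> S"
proof -
  have P: "profinite_graph X" using X by (simp add: connected_profinite_graph_def)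
  note top = profinite_topspace[OF P] and gr = profinite_is_graph[OF P]
  have S: "S \<subseteq> points X" using openin_subset[OF clopen(1)] top by simp
  have "continuous_map (graph_topology X) (discrete_topology UNIV) (\<lambda>x. x \<in> S)"
    unfolding continuous_map_def
  proof (intro conjI allI impI)
    fix U :: "bool set"
    have "{x \<in> points X. (x \<in> S) \<in> U} =
      (if True \<in> U then S else {}) \<union> (if False \<in> U then points X - S else {})"
      using S by (cases "True \<in> U"; cases "False \<in> U") (auto, (metis (full_types))+)
    moreover have "openin (graph_topology X) (points X - S)"
      using clopen(2) by (simp add: closedin_def top)
    ultimately show "openin (graph_topology X) {x \<in> topspace (graph_topology X). (x \<in> S) \<in> U}"
      using clopen(1) by (simp add: top openin_Un)
  qed auto
  from profinite_small_entourage[OF P kernel_entourage[OF P this]]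
  obtain R where R: "compatible_cofinite_entourage X R"
    "R \<subseteq> {(x, y) \<in> points X \<times> points X. (x \<in> S) = (y \<in> S)}" .
  have eq: "equiv (points X) R" and comp: "compatible_equiv X R"
    using R(1) by (auto simp: compatible_cofinite_entourage_def compatible_equiv_def)
  have symR: "(y, x) \<in> R" if "(x, y) \<in> R" for x y
    using eq that by (metis equivE symD)
  have reflR: "(x, x) \<in> R" if "x \<in> points X" for x
    using eq that by (metis equivE refl_onD)
  have vertR: "(v, e) \<notin> R" if "v \<in> verts X" "e \<in> edges X" for v e
    using comp that unfolding compatible_equiv_def by (elim conjE) blast
  have SR: "x \<in> S \<longleftrightarrow> y \<in> S" if "(x, y) \<in> R" for x y using R(2) that by blast
  let ?Q = "quotient_graph X R"
  have "path_connected_graph ?Q" using X R(1) by (simp add: connected_profinite_graph_def)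
  then have path: "(R `` {c}, R `` {v}) \<in> {(src ?Q e, tgt ?Q e) | e. e \<in> edges ?Q}\<^sup>*"
    using c v by (auto simp: path_connected_graph_def quotient_graph_def quotient_def)
  \<comment> \<open>The invariant along the path is that the class meets \<open>S\<close>; at its
    end, saturation of \<open>S\<close> under \<open>R\<close> brings \<open>v\<close> itself into
    \<open>S\<close>.\<close>
  have "\<exists>x\<in>S. x \<in> C" if "(R `` {c}, C) \<in> {(src ?Q e, tgt ?Q e) | e. e \<in> edges ?Q}\<^sup>*" for C
    using that
  proof (induction rule: rtrancl_induct)
    case base
    have "(c, c) \<in> R" using c(1) by (simp add: reflR points_def)
    with c show ?case by blast
  next
    case (step C D)
    then obtain E where E: "E \<in> edges X // R" "C = R `` (src X ` E)" "D = R `` (tgt X ` E)"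
      by (auto simp: quotient_graph_def)
    then obtain e where e: "e \<in> edges X" "E = R `` {e}" by (auto simp: quotient_def)
    obtain y where y: "y \<in> S" "y \<in> C" using step by blast
    \<comment> \<open>The source of an edge class collects everything related to the source of some
      member. So some edge \<open>e'\<close> in the class of \<open>e\<close> starts in the class of
      \<open>y\<close>, hence in \<open>S\<close>, although \<open>e\<close> was an arbitrary
      representative.\<close>
    then obtain e' where e': "(e, e') \<in> R" "(src X e', y) \<in> R" unfolding E e by blast
    then have "e' \<in> points X" using equiv_type[OF eq] by blast
    moreover have "e' \<notin> verts X" using vertR e(1) symR[OF e'(1)] by blast
    ultimately have e'X: "e' \<in> edges X" by (simp add: points_def)
    have "tgt X e' \<in> S"
      using assms(6)[OF e'X] SR[OF e'(2)] y(1) by blast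
    moreover have "(tgt X e', tgt X e') \<in> R"
      using graph_tgt[OF gr e'X] by (simp add: reflR points_def)
    ultimately show ?case unfolding E(3) e(2) using e'(1) by blast
  qed
  from this[OF path] show ?thesis using SR by blast
qed

text \<open>Path connectedness includes nonemptiness and there is at least one entourage, so some
  quotient has a point; an edge provides a vertex as its source.\<close>

lemma connected_profinite_has_vert:
  assumes "connected_profinite_graph X"
  obtains v where "v \<in> verts X"
proof -
  have P: "profinite_graph X" using assms by (simp add: connected_profinite_graph_def)
  have "entourages X \<noteq> {}"
    using profinite_uniformity[OF P] unfolding uniformity_on_def by (elim conjE)
  then obtain W where "W \<in> entourages X" by blast
  then obtain R where "compatible_cofinite_entourage X R"
    using profinite_small_entourage[OF P \<open>W \<in> entourages X\<close>] by blast
  then have "path_connected_graph (quotient_graph X R)"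
    using assms by (simp add: connected_profinite_graph_def)
  then have "verts X // R \<noteq> {} \<or> edges X // R \<noteq> {}"
    by (simp add: path_connected_graph_def points_def quotient_graph_def)
  then have "verts X \<noteq> {} \<or> edges X \<noteq> {}"
    unfolding quotient_def by blast
  then show thesis
    using that graph_src[OF profinite_is_graph[OF P]] by blast
qed

text \<open>Uniqueness is proved for maps to a single discrete level because there the set of
  agreement is open as well as closed; for maps into a Hausdorff space in general it is only
  closed.\<close>

lemma locally_constant_unique_lift:
  assumes X: "connected_profinite_graph X"
    and u: "graph_map X G u" "continuous_map (graph_topology X) (discrete_topology UNIV) u"
    and v: "graph_map X G v" "continuous_map (graph_topology X) (discrete_topology UNIV) v"
    and G: "is_graph G" and F: "locally_bijective G D F"
    and eq: "\<And>x. x \<in> points X \<Longrightarrow> F (u x) = F (v x)"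
    and c: "c \<in> verts X" "u c = v c" and x: "x \<in> points X"
  shows "u x = v x"
proof -
  have P: "profinite_graph X" using X by (simp add: connected_profinite_graph_def)
  note top = profinite_topspace[OF P] and gr = profinite_is_graph[OF P]
  \<comment> \<open>Injectivity on stars turns agreement at the source into agreement on the edge,
    and hence at its target.\<close>
  have edge: "u e = v e" if e: "e \<in> edges X" "u (src X e) = v (src X e)" for e
  proof (rule locally_bijective_inj[OF F G])
    show "src G (u e) = src G (v e)"
      using e(2) graph_map_src[OF u(1) e(1)] graph_map_src[OF v(1) e(1)] by simp
    show "u e \<in> edges G" "v e \<in> edges G"
      using e(1) graph_map_edges[OF u(1)] graph_map_edges[OF v(1)] by blast+
    show "F (u e) = F (v e)" using e(1) by (intro eq) (simp add: points_def)
  qed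
  let ?S = "{x \<in> points X. u x = v x}"
  have vert: "u y = v y" if "y \<in> verts X" for y
  proof -
    have "y \<in> ?S"
    proof (rule connected_profinite_clopen_induct[OF X _ _ c(1) _ _ that])
      show "openin (graph_topology X) ?S" "closedin (graph_topology X) ?S"
        using clopen_locally_constant[OF u(2) v(2), of "(=)"] unfolding top .
      show "c \<in> ?S" using c by (simp add: points_def)
      fix e assume e: "e \<in> edges X" "src X e \<in> ?S"
      then have "u (src X e) = v (src X e)" by blast
      then have "u e = v e" by (rule edge[OF e(1)])
      then have "u (tgt X e) = v (tgt X e)"
        by (simp only: graph_map_tgt[OF u(1) e(1)] graph_map_tgt[OF v(1) e(1)])
      then show "tgt X e \<in> ?S"
        using graph_tgt[OF gr e(1)] by (simp add: points_def)
    qed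
    then show ?thesis by simp
  qed
  show ?thesis
  proof (cases "x \<in> verts X")
    case True
    then show ?thesis by (rule vert)
  next
    case False
    with x have "x \<in> edges X" by (simp add: points_def)
    then show ?thesis by (rule edge) (rule vert[OF graph_src[OF gr \<open>x \<in> edges X\<close>]])
  qed
qed


subsection \<open>Profinite graphs as limits of finite graphs\<close>

text \<open>\<open>a x i\<close> is read as the coordinate of \<open>x\<close> at level
  \<open>i\<close>. Three facts carry the later arguments: coordinates are locally constant, they
  separate points, and every thread of vertices or of edges is the coordinate family of a
  point.\<close>

locale finite_presentation =
  fixes X :: "('a, 'm) ugraph_scheme" and I :: "'i set" and rel :: "'i \<Rightarrow> 'i \<Rightarrow> bool"
    and G :: "'i \<Rightarrow> 'x graph" and \<phi> :: "'i \<Rightarrow> 'i \<Rightarrow> 'x \<Rightarrow> 'x" and a :: "'a \<Rightarrow> 'i \<Rightarrow> 'x"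
  assumes profinite: "profinite_graph X"
    and system: "inverse_system I rel G \<phi>"
    and iso: "limit_iso X I rel G \<phi> a"
begin

lemma directed: "directed_on I rel"
  using system unfolding inverse_system_def by (elim conjE)

lemma index_nonempty: "I \<noteq> {}"
  using directed unfolding directed_on_def by (elim conjE)

lemma level_graph: "i \<in> I \<Longrightarrow> is_graph (G i)"
  and level_finite: "i \<in> I \<Longrightarrow> finite (points (G i))"
  using system unfolding inverse_system_def by blast+

lemma level_map: "i \<in> I \<Longrightarrow> j \<in> I \<Longrightarrow> rel i j \<Longrightarrow> graph_map (G j) (G i) (\<phi> i j)"
  using system unfolding inverse_system_def by (elim conjE) blast

lemma level_id: "i \<in> I \<Longrightarrow> x \<in> points (G i) \<Longrightarrow> \<phi> i i x = x"
  using system unfolding inverse_system_def by (elim conjE) blast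

lemma level_comp:
  "i \<in> I \<Longrightarrow> j \<in> I \<Longrightarrow> k \<in> I \<Longrightarrow> rel i j \<Longrightarrow> rel j k \<Longrightarrow> x \<in> points (G k) \<Longrightarrow>
    \<phi> i j (\<phi> j k x) = \<phi> i k x"
  using system unfolding inverse_system_def by (elim conjE) blast

lemma limit_map: "graph_map X (limit_graph I rel G \<phi>) a"
  and limit_homeo: "homeomorphic_map (graph_topology X) (limit_topology I rel G \<phi>) a"
  using iso by (simp_all add: limit_iso_def)

lemma coord_verts: "v \<in> verts X \<Longrightarrow> a v \<in> threads I rel \<phi> (\<lambda>i. verts (G i))"
  and coord_edges: "e \<in> edges X \<Longrightarrow> a e \<in> threads I rel \<phi> (\<lambda>i. edges (G i))"
  using graph_map_verts[OF limit_map] graph_map_edges[OF limit_map] by (simp_all add: limit_graph_def)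

lemma coord_graph_map:
  assumes "i \<in> I"
  shows "graph_map X (G i) (\<lambda>x. a x i)"
proof -
  have "a v i \<in> verts (G i)" if "v \<in> verts X" for v
    using coord_verts[OF that] assms by (auto simp: threads_def)
  moreover have "a e i \<in> edges (G i)" if "e \<in> edges X" for e
    using coord_edges[OF that] assms by (auto simp: threads_def)
  moreover have "a (src X e) i = src (G i) (a e i)" "a (tgt X e) i = tgt (G i) (a e i)"
    "a (rev_edge X e) i = rev_edge (G i) (a e i)" if "e \<in> edges X" for e
    using graph_map_src[OF limit_map that] graph_map_tgt[OF limit_map that]
      graph_map_rev[OF limit_map that] assms by (simp_all add: limit_graph_def)
  ultimately show ?thesis by (auto simp: graph_map_def)
qed

lemma coord_points: "x \<in> points X \<Longrightarrow> i \<in> I \<Longrightarrow> a x i \<in> points (G i)"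
  using graph_map_points[OF coord_graph_map] .

lemma coord_transition:
  assumes "x \<in> points X" "i \<in> I" "j \<in> I" "rel i j"
  shows "\<phi> i j (a x j) = a x i"
proof -
  have "a x \<in> threads I rel \<phi> (\<lambda>i. verts (G i)) \<or> a x \<in> threads I rel \<phi> (\<lambda>i. edges (G i))"
    using assms(1) coord_verts coord_edges by (auto simp: points_def)
  then show ?thesis using assms by (auto simp: threads_def)
qed

lemma coord_continuous:
  assumes "i \<in> I"
  shows "continuous_map (graph_topology X) (discrete_topology UNIV) (\<lambda>x. a x i)"
proof -
  have "continuous_map (graph_topology X) (product_topology (\<lambda>i. discrete_topology (points (G i))) I) a"
    using homeomorphic_imp_continuous_map[OF limit_homeo]
    by (simp add: limit_topology_def continuous_map_in_subtopology)
  from continuous_map_compose[OF this continuous_map_product_projection[OF assms]]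
  show ?thesis by (intro continuous_map_into_discrete_UNIV) (simp add: o_def)
qed

lemma coord_eqI:
  assumes x: "x \<in> points X" and y: "y \<in> points X" and eq: "\<And>i. i \<in> I \<Longrightarrow> a x i = a y i"
  shows "x = y"
proof -
  \<comment> \<open>Threads are \<open>undefined\<close> outside \<open>I\<close>, so agreement at
    the levels is equality of functions.\<close>
  have ext: "a z \<in> extensional I" if "z \<in> points X" for z
    using that coord_verts[of z] coord_edges[of z] by (auto simp: points_def threads_def PiE_def)
  have "inj_on a (points X)"
    using homeomorphic_imp_injective_map[OF limit_homeo] by (simp add: profinite_topspace[OF profinite])
  moreover have "a x = a y"
    by (rule extensionalityI[OF ext[OF x] ext[OF y] eq])
  ultimately show ?thesis using x y by (auto dest: inj_onD)
qed

lemma coord_surj: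
  assumes "z \<in> points (limit_graph I rel G \<phi>)"
  obtains x where "x \<in> points X" "a x = z"
proof -
  have "z \<in> Pi\<^sub>E I (\<lambda>i. points (G i))"
    using assms by (auto simp: points_def limit_graph_def threads_def PiE_def Pi_def)
  with assms have "z \<in> topspace (limit_topology I rel G \<phi>)"
    by (simp add: limit_topology_def)
  then have "z \<in> a ` points X"
    using homeomorphic_imp_surjective_map[OF limit_homeo] by (simp add: profinite_topspace[OF profinite])
  then show thesis using that by blast
qed

lemma coord_surj_verts:
  assumes z: "z \<in> threads I rel \<phi> (\<lambda>i. verts (G i))"
  obtains x where "x \<in> verts X" "a x = z"
proof -
  obtain x where x: "x \<in> points X" "a x = z"
    by (rule coord_surj[of z]) (use z in \<open>auto simp: points_def limit_graph_def\<close>)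
  \<comment> \<open>Any single level decides whether a point is a vertex or an edge.\<close>
  obtain i where i: "i \<in> I" using index_nonempty by blast
  then have "a x i \<in> verts (G i)" using x(2) z by (auto simp: threads_def)
  then have "x \<in> verts X"
    by (rule graph_map_reflects_verts[OF coord_graph_map[OF i] level_graph[OF i] x(1)])
  with x(2) show thesis using that by blast
qed

lemma coord_surj_edges:
  assumes z: "z \<in> threads I rel \<phi> (\<lambda>i. edges (G i))"
  obtains x where "x \<in> edges X" "a x = z"
proof -
  obtain x where x: "x \<in> points X" "a x = z"
    by (rule coord_surj[of z]) (use z in \<open>auto simp: points_def limit_graph_def\<close>)
  obtain i where i: "i \<in> I" using index_nonempty by blast
  then have "a x i \<in> edges (G i)" using x(2) z by (auto simp: threads_def)
  then have "x \<in> edges X"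
    by (rule graph_map_reflects_edges[OF coord_graph_map[OF i] level_graph[OF i] x(1)])
  with x(2) show thesis using that by blast
qed

end


subsection \<open>Coverings as limits of finite coverings\<close>

locale covering_system =
  up: finite_presentation Y I rel G \<phi> a + down: finite_presentation Z I rel D \<psi> b
  for Y :: "('a, 'm) ugraph_scheme" and Z :: "('b, 'n) ugraph_scheme"
    and I :: "'i set" and rel :: "'i \<Rightarrow> 'i \<Rightarrow> bool"
    and G :: "'i \<Rightarrow> 'x graph" and \<phi> a and D :: "'i \<Rightarrow> 'y graph" and \<psi> b +
  fixes f :: "'a \<Rightarrow> 'b" and F :: "'i \<Rightarrow> 'x \<Rightarrow> 'y"
  assumes cont: "cont_graph_map Y Z f"
    and level_covering: "i \<in> I \<Longrightarrow> graph_map (G i) (D i) (F i)"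
    and level_bij: "i \<in> I \<Longrightarrow> locally_bijective (G i) (D i) (F i)"
    and level_nat: "\<And>x. i \<in> I \<Longrightarrow> j \<in> I \<Longrightarrow> rel i j \<Longrightarrow> x \<in> points (G j) \<Longrightarrow>
      F i (\<phi> i j x) = \<psi> i j (F j x)"
    and coord: "\<And>x. x \<in> points Y \<Longrightarrow> i \<in> I \<Longrightarrow> b (f x) i = F i (a x i)"
begin

lemma cover_graph_map: "graph_map Y Z f"
  using cont by (simp add: cont_graph_map_def)

lemmas up_graph = profinite_is_graph[OF up.profinite]
  and down_graph = profinite_is_graph[OF down.profinite]

text \<open>Coordinates separate the points of \<open>Y\<close>, and each coordinate of a lift is a
  lift to a finite level.\<close>

lemma unique_lift:
  assumes X: "connected_profinite_graph X"
    and u: "cont_graph_map X Y u" and v: "cont_graph_map X Y v"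
    and eq: "\<And>x. x \<in> points X \<Longrightarrow> f (u x) = f (v x)"
    and c: "c \<in> verts X" "u c = v c" and x: "x \<in> points X"
  shows "u x = v x"
proof -
  have pts: "u x \<in> points Y" "v x \<in> points Y" if "x \<in> points X" for x
    using u v that by (auto simp: cont_graph_map_def intro: graph_map_points)
  have maps: "graph_map X (G i) (\<lambda>x. a (w x) i)"
    "continuous_map (graph_topology X) (discrete_topology UNIV) (\<lambda>x. a (w x) i)"
    if "cont_graph_map X Y w" "i \<in> I" for w i
    using that graph_map_compose[OF _ up.coord_graph_map] continuous_map_compose[OF _ up.coord_continuous]
    by (fastforce simp: cont_graph_map_def o_def)+
  have "a (u x) i = a (v x) i" if i: "i \<in> I" for i
  proof (rule locally_constant_unique_lift[OF X maps[OF u i] maps[OF v i]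
        up.level_graph[OF i] level_bij[OF i] _ c(1) _ x])
    show "F i (a (u y) i) = F i (a (v y) i)" if "y \<in> points X" for y
      using coord[OF pts(1)[OF that] i] coord[OF pts(2)[OF that] i] eq[OF that] by simp
    show "a (u c) i = a (v c) i" using c(2) by simp
  qed
  then show ?thesis by (rule up.coord_eqI[OF pts[OF x]])
qed

text \<open>Local bijectivity passes to the limit without a compactness argument. At each level the
  coordinate of \<open>e\<close> has exactly one lift starting at the coordinate of
  \<open>v\<close>; uniqueness forces these lifts to match under the transition maps, so they form a
  thread of edges.\<close>

lemma cover_locally_bijective: "locally_bijective Y Z f"
  unfolding locally_bijective_def
proof
  fix v assume v: "v \<in> verts Y"
  have fv: "f v \<in> verts Z" using graph_map_verts[OF cover_graph_map v] .
  have vp: "v \<in> points Y" "f v \<in> points Z" using v fv by (simp_all add: points_def)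
  have "inj_on f (star Y v)"
  proof (rule inj_onI)
    fix e e' assume "e \<in> star Y v" "e' \<in> star Y v" and eq: "f e = f e'"
    then have e: "e \<in> edges Y" "e' \<in> edges Y" "src Y e = src Y e'" by (simp_all add: star_def)
    then have ep: "e \<in> points Y" "e' \<in> points Y" by (simp_all add: points_def)
    show "e = e'"
    proof (rule up.coord_eqI[OF ep])
      fix i assume i: "i \<in> I"
      note g = up.coord_graph_map[OF i]
      show "a e i = a e' i"
      proof (rule locally_bijective_inj[OF level_bij[OF i] up.level_graph[OF i]
            graph_map_edges[OF g e(1)] graph_map_edges[OF g e(2)]])
        show "src (G i) (a e i) = src (G i) (a e' i)"
          using graph_map_src[OF g e(1)] graph_map_src[OF g e(2)] e(3) by simp
        show "F i (a e i) = F i (a e' i)"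
          using coord[OF ep(1) i] coord[OF ep(2) i] eq by simp
      qed
    qed
  qed
  moreover have "f ` star Y v \<subseteq> star Z (f v)"
    using graph_map_edges[OF cover_graph_map] graph_map_src[OF cover_graph_map]
    by (auto simp: star_def)
  moreover have "e \<in> f ` star Y v" if "e \<in> star Z (f v)" for e
  proof -
    have e: "e \<in> edges Z" "src Z e = f v" using that by (simp_all add: star_def)
    then have ep: "e \<in> points Z" by (simp add: points_def)
    have "\<exists>w. w \<in> edges (G i) \<and> src (G i) w = a v i \<and> F i w = b e i" if i: "i \<in> I" for i
    proof (rule locally_bijective_lift[OF level_bij[OF i]])
      show "a v i \<in> verts (G i)" using graph_map_verts[OF up.coord_graph_map[OF i] v] .
      show "b e i \<in> edges (D i)" using graph_map_edges[OF down.coord_graph_map[OF i] e(1)] .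
      show "src (D i) (b e i) = F i (a v i)"
        using graph_map_src[OF down.coord_graph_map[OF i] e(1)] e(2) coord[OF vp(1) i] by simp
    qed blast
    then obtain w where w: "\<And>i. i \<in> I \<Longrightarrow> w i \<in> edges (G i)"
      "\<And>i. i \<in> I \<Longrightarrow> src (G i) (w i) = a v i" "\<And>i. i \<in> I \<Longrightarrow> F i (w i) = b e i"
      by metis
    have trans: "\<phi> i j (w j) = w i" if ij: "i \<in> I" "j \<in> I" "rel i j" for i j
    proof -
      note g = up.level_map[OF ij]
      have wj: "w j \<in> points (G j)" using w(1)[OF ij(2)] by (simp add: points_def)
      show ?thesis
      proof (rule locally_bijective_inj[OF level_bij[OF ij(1)] up.level_graph[OF ij(1)]
            graph_map_edges[OF g w(1)[OF ij(2)]] w(1)[OF ij(1)]])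
        show "src (G i) (\<phi> i j (w j)) = src (G i) (w i)"
          using graph_map_src[OF g w(1)[OF ij(2)]] w(2)[OF ij(1)] w(2)[OF ij(2)]
            up.coord_transition[OF vp(1) ij] by simp
        show "F i (\<phi> i j (w j)) = F i (w i)"
          using level_nat[OF ij wj] w(3)[OF ij(1)] w(3)[OF ij(2)] down.coord_transition[OF ep ij]
          by simp
      qed
    qed
    have "restrict w I \<in> threads I rel \<phi> (\<lambda>i. edges (G i))"
      using w(1) trans by (auto simp: threads_def)
    then obtain y where y: "y \<in> edges Y" "a y = restrict w I"
      using up.coord_surj_edges by blast
    have yp: "y \<in> points Y" "src Y y \<in> points Y" "f y \<in> points Z"
      using y(1) graph_src[OF up_graph y(1)] graph_map_edges[OF cover_graph_map y(1)]
      by (simp_all add: points_def)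
    have "src Y y = v"
      by (rule up.coord_eqI[OF yp(2) vp(1)])
        (simp add: graph_map_src[OF up.coord_graph_map y(1)] y(2) w(2))
    moreover have "f y = e"
      by (rule down.coord_eqI[OF yp(3) ep]) (simp add: coord[OF yp(1)] y(2) w(3))
    ultimately show ?thesis using y(1) by (auto simp: star_def)
  qed
  ultimately show "bij_betw f (star Y v) (star Z (f v))"
    unfolding bij_betw_def by blast
qed

text \<open>The transition maps are not assumed surjective, so \<open>D i\<close> may have parts
  that \<open>Z\<close> does not reach and over which \<open>F i\<close> has empty fibres. The claim
  is restricted to coordinates of vertices of \<open>Z\<close>, where clopen induction starts from
  the image of \<open>c\<close>.\<close>

lemma level_lift:
  assumes Z: "connected_profinite_graph Z" and c: "c \<in> verts Y" and i: "i \<in> I" and z: "z \<in> verts Z"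
  shows "\<exists>w\<in>verts (G i). F i w = b z i"
proof -
  let ?S = "{z \<in> points Z. \<exists>w\<in>verts (G i). F i w = b z i}"
  note g = down.coord_graph_map[OF i]
  have "z \<in> ?S"
  proof (rule connected_profinite_clopen_induct[OF Z _ _ _ _ _ z])
    show "openin (graph_topology Z) ?S" "closedin (graph_topology Z) ?S"
      using clopen_locally_constant1[OF down.coord_continuous[OF i], of "\<lambda>t. \<exists>w\<in>verts (G i). F i w = t"]
      unfolding profinite_topspace[OF down.profinite] .
    show fc: "f c \<in> verts Z" using graph_map_verts[OF cover_graph_map c] .
    have "a c i \<in> verts (G i)" using graph_map_verts[OF up.coord_graph_map[OF i] c] .
    moreover have "F i (a c i) = b (f c) i" using coord[of c i] i c by (simp add: points_def)
    ultimately show "f c \<in> ?S" using fc by (auto simp: points_def)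
    fix e assume e: "e \<in> edges Z" "src Z e \<in> ?S"
    then obtain w where w: "w \<in> verts (G i)" "F i w = b (src Z e) i" by blast
    obtain e' where e': "e' \<in> edges (G i)" "src (G i) e' = w" "F i e' = b e i"
    proof (rule locally_bijective_lift[OF level_bij[OF i] w(1)])
      show "b e i \<in> edges (D i)" using graph_map_edges[OF g e(1)] .
      show "src (D i) (b e i) = F i w" using graph_map_src[OF g e(1)] w(2) by simp
    qed
    have "F i (tgt (G i) e') = b (tgt Z e) i"
      using graph_map_tgt[OF level_covering[OF i] e'(1)] graph_map_tgt[OF g e(1)] e'(3) by simp
    moreover have "tgt (G i) e' \<in> verts (G i)" using graph_tgt[OF up.level_graph[OF i] e'(1)] .
    ultimately show "tgt Z e \<in> ?S"
      using graph_tgt[OF down_graph e(1)] by (auto simp: points_def)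
  qed
  then show ?thesis by blast
qed

text \<open>The fibres over the coordinates of \<open>z\<close> are finite and nonempty and form an
  inverse system; a thread through them is the coordinate family of a vertex over
  \<open>z\<close>.\<close>

lemma cover_surj_verts:
  assumes Z: "connected_profinite_graph Z" and c: "c \<in> verts Y" and z: "z \<in> verts Z"
  obtains y where "y \<in> verts Y" "f y = z"
proof -
  have zp: "z \<in> points Z" using z by (simp add: points_def)
  let ?A = "\<lambda>i. {w \<in> verts (G i). F i w = b z i}"
  have "threads I rel \<phi> ?A \<noteq> {}"
  proof (rule threads_nonempty[OF up.directed])
    show "finite (?A i)" if "i \<in> I" for i
      using up.level_finite[OF that] by (simp add: points_def)
    show "?A i \<noteq> {}" if "i \<in> I" for i
      using level_lift[OF Z c that z] by blast
    show "\<phi> i j x \<in> ?A i" if "i \<in> I" "j \<in> I" "rel i j" "x \<in> ?A j" for i j x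
      using graph_map_verts[OF up.level_map[OF that(1-3)], of x] level_nat[OF that(1-3), of x]
        down.coord_transition[OF zp that(1-3)] that(4) by (simp add: points_def)
    show "\<phi> i i x = x" if "i \<in> I" "x \<in> ?A i" for i x
      using up.level_id[OF that(1)] that(2) by (simp add: points_def)
    show "\<phi> i j (\<phi> j k x) = \<phi> i k x"
      if "i \<in> I" "j \<in> I" "k \<in> I" "rel i j" "rel j k" "x \<in> ?A k" for i j k x
      using up.level_comp[OF that(1-5)] that(6) by (simp add: points_def)
  qed
  then obtain t where t: "t \<in> threads I rel \<phi> ?A" by blast
  then have "t \<in> threads I rel \<phi> (\<lambda>i. verts (G i))" by (auto simp: threads_def PiE_def Pi_def)
  then obtain y where y: "y \<in> verts Y" "a y = t" using up.coord_surj_verts by blast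
  then have yp: "y \<in> points Y" "f y \<in> points Z"
    using graph_map_verts[OF cover_graph_map] by (simp_all add: points_def)
  have "f y = z"
  proof (rule down.coord_eqI[OF yp(2) zp])
    fix i assume i: "i \<in> I"
    have "F i (t i) = b z i" using t i by (auto simp: threads_def)
    then show "b (f y) i = b z i" using coord[OF yp(1) i] y(2) by simp
  qed
  with y(1) show thesis using that by blast
qed

text \<open>An edge is lifted from a vertex over its source by local bijectivity.\<close>

lemma cover_surj:
  assumes Z: "connected_profinite_graph Z" and c: "c \<in> verts Y"
  shows "f ` points Y = points Z"
proof
  show "f ` points Y \<subseteq> points Z" using graph_map_points[OF cover_graph_map] by blast
  show "points Z \<subseteq> f ` points Y"
  proof
    fix z assume "z \<in> points Z"
    then consider "z \<in> verts Z" | "z \<in> edges Z" by (auto simp: points_def)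
    then show "z \<in> f ` points Y"
    proof cases
      case 1
      from cover_surj_verts[OF Z c this] show ?thesis by (metis UnI1 imageI points_def)
    next
      case 2
      obtain y where y: "y \<in> verts Y" "f y = src Z z"
        using cover_surj_verts[OF Z c graph_src[OF down_graph 2]] .
      from locally_bijective_lift[OF cover_locally_bijective y(1) 2 y(2)[symmetric]]
      show ?thesis by (metis UnI2 imageI points_def)
    qed
  qed
qed

end

lemma coveringE:
  fixes \<Gamma> :: "('a, 'm) ugraph_scheme" and \<Delta> :: "('b, 'n) ugraph_scheme"
  assumes "covering \<Gamma> \<Delta> f"
  obtains I :: "(nat + 'a + 'b) set" and rel and G :: "_ \<Rightarrow> nat graph" and D :: "_ \<Rightarrow> nat graph"
    and \<phi> \<psi> F a b
  where "covering_system \<Gamma> \<Delta> I rel G \<phi> a D \<psi> b f F"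
proof -
  from assms obtain I :: "(nat + 'a + 'b) set" and rel and G :: "_ \<Rightarrow> nat graph"
    and D :: "_ \<Rightarrow> nat graph" and \<phi> \<psi> F a b
    where "profinite_graph \<Gamma>" "profinite_graph \<Delta>" "cont_graph_map \<Gamma> \<Delta> f"
      "inverse_system I rel G \<phi>" "inverse_system I rel D \<psi>"
      "\<forall>i\<in>I. graph_map (G i) (D i) (F i) \<and> locally_bijective (G i) (D i) (F i)"
      "\<forall>i\<in>I. \<forall>j\<in>I. rel i j \<longrightarrow> (\<forall>x\<in>points (G j). F i (\<phi> i j x) = \<psi> i j (F j x))"
      "limit_iso \<Gamma> I rel G \<phi> a" "limit_iso \<Delta> I rel D \<psi> b"
      "\<forall>x\<in>points \<Gamma>. b (f x) = (\<lambda>i\<in>I. F i (a x i))"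
    unfolding covering_def by (elim conjE exE)
  then have "covering_system \<Gamma> \<Delta> I rel G \<phi> a D \<psi> b f F"
    by unfold_locales simp_all
  then show thesis by (rule that)
qed


subsection \<open>Transport of structure\<close>

text \<open>This supplies the profinite structure of the orbit graph: the points of \<open>Y\<close>
  are renamed by the injection \<open>k\<close>, and the uniformity is the one that makes
  \<open>k\<close> an isomorphism. The graph structure of \<open>Q\<close> is prescribed by
  equations on the image only, so that \<open>Q\<close> can be given beforehand by another
  formula.\<close>

lemma profinite_graph_transport:
  assumes Y: "profinite_graph Y" and inj: "inj_on k (points Y)"
    and verts: "verts Q = k ` verts Y" and edges: "edges Q = k ` edges Y"
    and maps: "\<And>e. e \<in> edges Y \<Longrightarrow> src Q (k e) = k (src Y e) \<and> tgt Q (k e) = k (tgt Y e) \<and>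
      rev_edge Q (k e) = k (rev_edge Y e)"
    and ent: "entourages Q =
      {W. W \<subseteq> points Q \<times> points Q \<and> {(x, y) \<in> points Y \<times> points Y. (k x, k y) \<in> W} \<in> entourages Y}"
  shows "profinite_graph_iso Y Q k"
proof -
  note gr = profinite_is_graph[OF Y] and U = profinite_uniformity[OF Y]
    and topY = profinite_topspace[OF Y]
  have pts: "points Q = k ` points Y" by (auto simp: points_def verts edges)
  have k_eq: "k x = k y \<longleftrightarrow> x = y" if "x \<in> points Y" "y \<in> points Y" for x y
    using inj that by (auto dest: inj_onD)
  have vp: "v \<in> points Y" if "v \<in> verts Y" for v using that by (simp add: points_def)
  have ep: "e \<in> points Y" if "e \<in> edges Y" for e using that by (simp add: points_def)
  \<comment> \<open>\<open>P\<close> pulls relations back along \<open>k\<close> and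
    \<open>L\<close> pushes them forward. By injectivity \<open>L\<close> is a section of
    \<open>P\<close>, and every axiom for \<open>Q\<close> is checked by moving relations through
    these two operations.\<close>
  define P where "P W = {(x, y) \<in> points Y \<times> points Y. (k x, k y) \<in> W}" for W
  define L where "L V = map_prod k k ` V" for V
  have P_iff: "(x, y) \<in> P W \<longleftrightarrow> x \<in> points Y \<and> y \<in> points Y \<and> (k x, k y) \<in> W" for x y W
    by (simp add: P_def)
  have entQ: "W \<in> entourages Q \<longleftrightarrow> W \<subseteq> points Q \<times> points Q \<and> P W \<in> entourages Y" for W
    by (simp add: ent P_def)
  have L_iff: "(k x, k y) \<in> L V \<longleftrightarrow> (x, y) \<in> V"
    if "V \<subseteq> points Y \<times> points Y" "x \<in> points Y" "y \<in> points Y" for x y V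
  proof
    assume "(k x, k y) \<in> L V"
    then obtain x' y' where xy: "(x', y') \<in> V" "k x = k x'" "k y = k y'"
      by (auto simp: L_def)
    then have "x = x'" "y = y'" using that k_eq by blast+
    with xy(1) show "(x, y) \<in> V" by simp
  qed (force simp: L_def)
  have L_cases: "\<exists>x y. s = k x \<and> t = k y \<and> (x, y) \<in> V" if "(s, t) \<in> L V" for s t V
    using that by (auto simp: L_def)
  have PL: "P (L V) = V" if V: "V \<subseteq> points Y \<times> points Y" for V
    using V L_iff[OF V] by (auto simp: P_iff)
  have L_sub: "L V \<subseteq> points Q \<times> points Q" if "V \<subseteq> points Y \<times> points Y" for V
    using that by (auto simp: L_def pts)
  have L_ent: "L V \<in> entourages Q" if V: "V \<in> entourages Y" for V
    using uniformity_on_subset[OF U V] V by (simp add: entQ PL L_sub)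
  have U_ne: "entourages Y \<noteq> {}"
    using U unfolding uniformity_on_def by (elim conjE)
  have "\<forall>W\<in>entourages Y. Id_on (points Y) \<subseteq> W \<and> W \<subseteq> points Y \<times> points Y"
    using U unfolding uniformity_on_def by (elim conjE)
  then have U_refl: "\<And>W. W \<in> entourages Y \<Longrightarrow> Id_on (points Y) \<subseteq> W" by blast
  have "\<forall>W\<in>entourages Y. W\<inverse> \<in> entourages Y"
    using U unfolding uniformity_on_def by (elim conjE)
  then have U_conv: "\<And>W. W \<in> entourages Y \<Longrightarrow> W\<inverse> \<in> entourages Y" by blast
  have "\<forall>W\<in>entourages Y. \<exists>W'\<in>entourages Y. W' O W' \<subseteq> W"
    using U unfolding uniformity_on_def by (elim conjE)
  then have U_comp: "\<And>W. W \<in> entourages Y \<Longrightarrow> \<exists>W'\<in>entourages Y. W' O W' \<subseteq> W" by blast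
  have UQ: "uniformity_on (points Q) (entourages Q)"
    unfolding uniformity_on_def
  proof (intro conjI ballI allI impI)
    show "entourages Q \<noteq> {}" using U_ne L_ent by blast
    fix W assume W: "W \<in> entourages Q"
    then have PW: "P W \<in> entourages Y" and WQ: "W \<subseteq> points Q \<times> points Q" by (simp_all add: entQ)
    show "W \<subseteq> points Q \<times> points Q" by (rule WQ)
    show "Id_on (points Q) \<subseteq> W"
    proof (rule subrelI)
      fix s t assume "(s, t) \<in> Id_on (points Q)"
      then obtain x where x: "x \<in> points Y" "s = k x" "t = k x" by (auto simp: pts)
      then have "(x, x) \<in> P W" using U_refl[OF PW] by blast
      with x show "(s, t) \<in> W" by (simp add: P_iff)
    qed
    show "W' \<in> entourages Q" if W': "W \<subseteq> W' \<and> W' \<subseteq> points Q \<times> points Q" for W'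
    proof -
      have "P W \<subseteq> P W'" using W' by (auto simp: P_def)
      moreover have "P W' \<subseteq> points Y \<times> points Y" by (auto simp: P_def)
      ultimately have "P W' \<in> entourages Y" by (rule uniformity_on_superset[OF U PW])
      with W' show ?thesis by (simp add: entQ)
    qed
    show "W \<inter> W' \<in> entourages Q" if W': "W' \<in> entourages Q" for W'
    proof -
      have "P (W \<inter> W') = P W \<inter> P W'" by (auto simp: P_def)
      moreover have "P W \<inter> P W' \<in> entourages Y"
        using W' by (intro uniformity_on_Int[OF U PW]) (simp add: entQ)
      ultimately show ?thesis using WQ by (auto simp: entQ)
    qed
    have "P (W\<inverse>) = (P W)\<inverse>" by (auto simp: P_def)
    then show "W\<inverse> \<in> entourages Q" using U_conv[OF PW] WQ by (auto simp: entQ)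
    obtain V where V: "V \<in> entourages Y" "V O V \<subseteq> P W" using U_comp[OF PW] by blast
    have "L V O L V \<subseteq> W"
    proof (rule subrelI)
      fix s t assume "(s, t) \<in> L V O L V"
      then obtain r where "(s, r) \<in> L V" "(r, t) \<in> L V" by blast
      then obtain x y y' z where xyz: "s = k x" "r = k y" "(x, y) \<in> V" "r = k y'" "t = k z" "(y', z) \<in> V"
        using L_cases by metis
      then have "y = y'" using uniformity_on_subset[OF U V(1)] k_eq[of y y'] by auto
      then have "(x, z) \<in> P W" using V(2) xyz by blast
      then show "(s, t) \<in> W" using xyz by (simp add: P_iff)
    qed
    then show "\<exists>W'\<in>entourages Q. W' O W' \<subseteq> W" using L_ent[OF V(1)] by blast
  qed
  have topQ: "topspace (graph_topology Q) = points Q" by (rule topspace_uniform_topology[OF UQ])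
  have open_iff: "openin (graph_topology Y) {y \<in> points Y. k y \<in> S} \<longleftrightarrow> openin (graph_topology Q) S"
    if S: "S \<subseteq> points Q" for S
  proof
    assume *: "openin (graph_topology Y) {y \<in> points Y. k y \<in> S}"
    show "openin (graph_topology Q) S"
      unfolding openin_uniform_topology[OF UQ]
    proof (intro conjI ballI S)
      fix s assume "s \<in> S"
      then obtain y where y: "y \<in> points Y" "s = k y" "k y \<in> S" using S pts by auto
      then obtain V where V: "V \<in> entourages Y" "V `` {y} \<subseteq> {y \<in> points Y. k y \<in> S}"
        using * unfolding openin_uniform_topology[OF U] by blast
      have "L V `` {s} \<subseteq> S"
      proof
        fix t assume "t \<in> L V `` {s}"
        then have st: "(k y, t) \<in> L V" using y(2) by simp
        obtain x z where xz: "k y = k x" "t = k z" "(x, z) \<in> V" using L_cases[OF st] by blast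
        then have "y = x" using uniformity_on_subset[OF U V(1)] k_eq[OF y(1), of x] by auto
        then show "t \<in> S" using V(2) xz by blast
      qed
      then show "\<exists>W\<in>entourages Q. W `` {s} \<subseteq> S" using L_ent[OF V(1)] by blast
    qed
  next
    assume *: "openin (graph_topology Q) S"
    show "openin (graph_topology Y) {y \<in> points Y. k y \<in> S}"
      unfolding openin_uniform_topology[OF U]
    proof (intro conjI ballI)
      fix y assume y: "y \<in> {y \<in> points Y. k y \<in> S}"
      then obtain W where W: "W \<in> entourages Q" "W `` {k y} \<subseteq> S"
        using * unfolding openin_uniform_topology[OF UQ] by blast
      have "P W `` {y} \<subseteq> {y \<in> points Y. k y \<in> S}" using W(2) by (auto simp: P_def)
      then show "\<exists>V\<in>entourages Y. V `` {y} \<subseteq> {y \<in> points Y. k y \<in> S}"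
        using W(1) by (auto simp: entQ)
    qed auto
  qed
  have homeo: "homeomorphic_map (graph_topology Y) (graph_topology Q) k"
    unfolding homeomorphic_map_def quotient_map_def topY topQ
    using open_iff inj pts by blast
  then have space: "graph_topology Y homeomorphic_space graph_topology Q"
    by (rule homeomorphic_map_imp_homeomorphic_space)
  have Haus: "Hausdorff_space (graph_topology Q)"
    using homeomorphic_Hausdorff_space[OF space] profinite_Hausdorff[OF Y] by simp
  have compact: "compact_space (graph_topology Q)"
    using homeomorphic_compact_space[OF space] profinite_compact[OF Y] by simp
  have grQ: "is_graph Q"
    unfolding is_graph_def
  proof (intro conjI ballI)
    show "verts Q \<inter> edges Q = {}"
    proof (rule ccontr)
      assume "verts Q \<inter> edges Q \<noteq> {}"
      then obtain v e where ve: "v \<in> verts Y" "e \<in> edges Y" "k v = k e" by (auto simp: verts edges)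
      then have "v = e" using k_eq[OF vp[OF ve(1)] ep[OF ve(2)]] by simp
      with ve show False using graph_disjoint[OF gr] by blast
    qed
    fix s assume "s \<in> edges Q"
    then obtain e where e: "e \<in> edges Y" "s = k e" by (auto simp: edges)
    note e' = graph_rev[OF gr e(1)]
    have rev_rev: "rev_edge Y (rev_edge Y e) = e" and tgt_rev: "tgt Y (rev_edge Y e) = src Y e"
      using gr e(1) unfolding is_graph_def by blast+
    show "src Q s \<in> verts Q" "tgt Q s \<in> verts Q" "rev_edge Q s \<in> edges Q"
      using maps[OF e(1)] e graph_src[OF gr e(1)] graph_tgt[OF gr e(1)] e'
      by (simp_all add: verts edges)
    show "rev_edge Q (rev_edge Q s) = s" "src Q (rev_edge Q s) = tgt Q s" "tgt Q (rev_edge Q s) = src Q s"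
      using maps[OF e(1)] maps[OF e'] e(2) rev_rev tgt_rev graph_src_rev[OF gr e(1)] by simp_all
    show "rev_edge Q s \<noteq> s"
      using maps[OF e(1)] e(2) k_eq[OF ep[OF e'] ep[OF e(1)]] graph_rev_neq[OF gr e(1)] by simp
  qed
  have small: "\<exists>R. compatible_cofinite_entourage Q R \<and> R \<subseteq> W" if W: "W \<in> entourages Q" for W
  proof -
    have "P W \<in> entourages Y" using W by (simp add: entQ)
    then obtain R where R: "compatible_cofinite_entourage Y R" "R \<subseteq> P W"
      by (rule profinite_small_entourage[OF Y])
    then have RU: "R \<in> entourages Y" and comp: "compatible_equiv Y R" and fin: "finite (points Y // R)"
      by (simp_all add: compatible_cofinite_entourage_def)
    note RY = uniformity_on_subset[OF U RU]
    have eq: "equiv (points Y) R" using comp by (simp add: compatible_equiv_def)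
    have eqQ: "equiv (points Q) (L R)"
    proof (rule equivI)
      show "L R \<subseteq> points Q \<times> points Q" by (rule L_sub[OF RY])
      show "refl_on (points Q) (L R)"
        using eq L_iff[OF RY] by (auto simp: refl_on_def pts elim!: equivE)
      show "sym (L R)"
      proof (rule symI)
        fix s t assume "(s, t) \<in> L R"
        then obtain x y where xy: "s = k x" "t = k y" "(x, y) \<in> R" using L_cases by blast
        then have "(y, x) \<in> R" using eq by (metis equivE symD)
        then show "(t, s) \<in> L R" unfolding L_def xy by force
      qed
      show "trans (L R)"
      proof (rule transI)
        fix s t r assume "(s, t) \<in> L R" "(t, r) \<in> L R"
        then obtain x y y' z where xyz: "s = k x" "t = k y" "(x, y) \<in> R" "t = k y'" "r = k z" "(y', z) \<in> R"
          using L_cases by metis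
        then have "y = y'" using RY k_eq[of y y'] by auto
        then have "(x, z) \<in> R" using xyz eq by (metis equivE transD)
        then show "(s, r) \<in> L R" unfolding L_def xyz(1,5) by force
      qed
    qed
    have compE: "(src Y e, src Y e') \<in> R" "(tgt Y e, tgt Y e') \<in> R" "(rev_edge Y e, rev_edge Y e') \<in> R"
      if "e \<in> edges Y" "e' \<in> edges Y" "(e, e') \<in> R" for e e'
      using comp that unfolding compatible_equiv_def by blast+
    have compV: "(v, e) \<notin> R" if "v \<in> verts Y" "e \<in> edges Y" for v e
      using comp that unfolding compatible_equiv_def by blast
    have compR: "(e, rev_edge Y e) \<notin> R" if "e \<in> edges Y" for e
      using comp that unfolding compatible_equiv_def by blast
    have L_I: "(k x, k y) \<in> L R" if "(x, y) \<in> R" for x y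
      using that unfolding L_def by force
    have compQ: "compatible_equiv Q (L R)"
      unfolding compatible_equiv_def
    proof (intro conjI ballI impI eqQ)
      fix s t assume "s \<in> verts Q" "t \<in> edges Q"
      then obtain v e where ve: "v \<in> verts Y" "e \<in> edges Y" "s = k v" "t = k e"
        by (auto simp: verts edges)
      then show "(s, t) \<notin> L R"
        using compV[OF ve(1,2)] L_iff[OF RY vp[OF ve(1)] ep[OF ve(2)]] by simp
    next
      fix s t assume "s \<in> edges Q" "t \<in> edges Q" and st: "(s, t) \<in> L R"
      then obtain e e' where e: "e \<in> edges Y" "e' \<in> edges Y" "s = k e" "t = k e'"
        by (auto simp: edges)
      then have R': "(e, e') \<in> R" using st L_iff[OF RY ep[OF e(1)] ep[OF e(2)]] by simp
      show "(src Q s, src Q t) \<in> L R" "(tgt Q s, tgt Q t) \<in> L R" "(rev_edge Q s, rev_edge Q t) \<in> L R"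
        using maps[OF e(1)] maps[OF e(2)] compE[OF e(1,2) R'] by (simp_all add: e(3,4) L_I)
    next
      fix s assume "s \<in> edges Q"
      then obtain e where e: "e \<in> edges Y" "s = k e" by (auto simp: edges)
      then show "(s, rev_edge Q s) \<notin> L R"
        using maps[OF e(1)] compR[OF e(1)] L_iff[OF RY ep[OF e(1)] ep[OF graph_rev[OF gr e(1)]]]
        by simp
    qed
    have finQ: "finite (points Q // L R)"
    proof (rule finite_subset)
      show "points Q // L R \<subseteq> (image k) ` (points Y // R)"
      proof
        fix C assume "C \<in> points Q // L R"
        then obtain s where "s \<in> points Q" "C = L R `` {s}" by (rule quotientE)
        then obtain x where x: "x \<in> points Y" "C = L R `` {k x}" by (auto simp: pts)
        have "L R `` {k x} = k ` (R `` {x})"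
        proof (intro equalityI subsetI)
          fix t assume "t \<in> L R `` {k x}"
          then have t: "(k x, t) \<in> L R" by simp
          obtain x' y where xy: "k x = k x'" "t = k y" "(x', y) \<in> R" using L_cases[OF t] by blast
          then have "x = x'" using RY k_eq[OF x(1), of x'] by auto
          with xy show "t \<in> k ` (R `` {x})" by blast
        qed (use L_I in blast)
        then show "C \<in> (image k) ` (points Y // R)"
          unfolding x(2) using quotientI[OF x(1), of R] by blast
      qed
      show "finite ((image k) ` (points Y // R))" using fin by simp
    qed
    have "L R \<subseteq> W"
    proof (rule subrelI)
      fix s t assume "(s, t) \<in> L R"
      then obtain x y where xy: "s = k x" "t = k y" "(x, y) \<in> R" using L_cases by blast
      then show "(s, t) \<in> W" using R(2) by (auto simp: P_iff)
    qed
    then show ?thesis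
      using L_ent[OF RU] compQ finQ by (auto simp: compatible_cofinite_entourage_def)
  qed
  have "profinite_graph Q"
    unfolding profinite_graph_def cofinite_graph_def using grQ UQ Haus compact small by blast
  moreover have "graph_map Y Q k"
    unfolding graph_map_def using maps by (auto simp: verts edges)
  ultimately show ?thesis
    using Y homeo by (simp add: profinite_graph_iso_def)
qed


subsection \<open>The automorphism group\<close>

lemma covering_aut_iff:
  "g \<in> carrier (covering_aut X p) \<longleftrightarrow> g \<in> extensional (points X) \<and> graph_map X X g \<and>
    homeomorphic_map (graph_topology X) (graph_topology X) g \<and> (\<forall>x\<in>points X. p (g x) = p x)"
  by (simp add: covering_aut_def)

lemma covering_aut_map: "g \<in> carrier (covering_aut X p) \<Longrightarrow> graph_map X X g"
  and covering_aut_homeo: "g \<in> carrier (covering_aut X p) \<Longrightarrow>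
    homeomorphic_map (graph_topology X) (graph_topology X) g"
  and covering_aut_proj: "g \<in> carrier (covering_aut X p) \<Longrightarrow> x \<in> points X \<Longrightarrow> p (g x) = p x"
  and covering_aut_ext: "g \<in> carrier (covering_aut X p) \<Longrightarrow> g \<in> extensional (points X)"
  unfolding covering_aut_iff by blast+

text \<open>An explicit inverse on the points supplies the homeomorphism; \<open>restrict\<close>
  then brings the map into the normal form of the group elements, \<open>undefined\<close> off the
  graph.\<close>

lemma covering_aut_I:
  assumes X: "profinite_graph X"
    and u: "cont_graph_map X X u" and v: "cont_graph_map X X v"
    and uv: "\<And>x. x \<in> points X \<Longrightarrow> u (v x) = x" and vu: "\<And>x. x \<in> points X \<Longrightarrow> v (u x) = x"
    and p: "\<And>x. x \<in> points X \<Longrightarrow> p (u x) = p x"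
  shows "restrict u (points X) \<in> carrier (covering_aut X p)"
proof -
  have "homeomorphic_maps (graph_topology X) (graph_topology X) u v"
    unfolding homeomorphic_maps_def profinite_topspace[OF X]
    using u v uv vu by (intro conjI ballI) (simp_all only: cont_graph_map_def)
  then have "homeomorphic_map (graph_topology X) (graph_topology X) u"
    by (rule homeomorphic_maps_imp_map)
  then have "homeomorphic_map (graph_topology X) (graph_topology X) (restrict u (points X))"
    by (rule homeomorphic_map_eq) (simp add: profinite_topspace[OF X])
  moreover have "graph_map X X (restrict u (points X))"
  proof (rule graph_map_cong[OF profinite_is_graph[OF X]])
    show "graph_map X X u" using u unfolding cont_graph_map_def by (rule conjunct1)
  qed simp
  moreover have "p (restrict u (points X) x) = p x" if "x \<in> points X" for x
    using p[OF that] that by (simp only: restrict_apply' )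
  ultimately show ?thesis
    unfolding covering_aut_iff by (intro conjI ballI restrict_extensional)
qed

lemma covering_aut_points:
  "g \<in> carrier (covering_aut X p) \<Longrightarrow> x \<in> points X \<Longrightarrow> g x \<in> points X"
  by (rule graph_map_points[OF covering_aut_map])

lemma covering_aut_cont:
  "g \<in> carrier (covering_aut X p) \<Longrightarrow> cont_graph_map X X g"
  unfolding cont_graph_map_def
  by (blast intro: covering_aut_map homeomorphic_imp_continuous_map[OF covering_aut_homeo])

lemma covering_aut_inverse:
  assumes X: "profinite_graph X" and g: "g \<in> carrier (covering_aut X p)"
  shows "\<exists>g'\<in>carrier (covering_aut X p). \<forall>x\<in>points X. g' (g x) = x \<and> g (g' x) = x"
proof -
  note gr = profinite_is_graph[OF X]
  obtain v where v: "homeomorphic_maps (graph_topology X) (graph_topology X) g v"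
    using covering_aut_homeo[OF g] unfolding homeomorphic_map_maps by blast
  then have vcont: "continuous_map (graph_topology X) (graph_topology X) v"
    and vg: "\<And>x. x \<in> points X \<Longrightarrow> v (g x) = x" and gv: "\<And>x. x \<in> points X \<Longrightarrow> g (v x) = x"
    by (simp_all add: homeomorphic_maps_def profinite_topspace[OF X])
  have vp: "v x \<in> points X" if "x \<in> points X" for x
    using continuous_map_image_subset_topspace[OF vcont] that
    by (auto simp: profinite_topspace[OF X])
  have "graph_map X X v"
    using gv vg vp by (intro graph_map_inverse[OF gr gr covering_aut_map[OF g]]) blast+
  with vcont have v': "cont_graph_map X X v" by (simp add: cont_graph_map_def)
  have "p (v x) = p x" if "x \<in> points X" for x
  proof -
    show ?thesis using covering_aut_proj[OF g vp[OF that]] unfolding gv[OF that] by (rule sym)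
  qed
  then have "restrict v (points X) \<in> carrier (covering_aut X p)"
    using covering_aut_I[where u = v and v = g, OF X v' covering_aut_cont[OF g], of p] vg gv by blast
  then show ?thesis
    using vg gv covering_aut_points[OF g] by (intro bexI) simp_all
qed

lemma covering_aut_group:
  assumes X: "profinite_graph X"
  shows "group (covering_aut X p)"
proof (rule groupI)
  let ?A = "covering_aut X p"
  have mult: "x \<otimes>\<^bsub>?A\<^esub> y = compose (points X) x y" for x y by (simp add: covering_aut_def)
  have one: "\<one>\<^bsub>?A\<^esub> = (\<lambda>x\<in>points X. x)" by (simp add: covering_aut_def)
  have ext: "x \<in> extensional (points X)" if "x \<in> carrier ?A" for x
    using that by (rule covering_aut_ext)
  show "x \<otimes>\<^bsub>?A\<^esub> y \<in> carrier ?A" if xy: "x \<in> carrier ?A" "y \<in> carrier ?A" for x y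
  proof -
    have "homeomorphic_map (graph_topology X) (graph_topology X) (x \<circ> y)"
      by (rule homeomorphic_map_compose[OF covering_aut_homeo[OF xy(2)] covering_aut_homeo[OF xy(1)]])
    then have "homeomorphic_map (graph_topology X) (graph_topology X) (compose (points X) x y)"
      by (rule homeomorphic_map_eq) (simp add: profinite_topspace[OF X] compose_def)
    moreover have "graph_map X X (x \<circ> y)"
      by (rule graph_map_compose[OF covering_aut_map[OF xy(2)] covering_aut_map[OF xy(1)]])
    then have "graph_map X X (compose (points X) x y)"
      by (rule graph_map_cong[OF profinite_is_graph[OF X]]) (simp add: compose_def)
    moreover have "p (compose (points X) x y z) = p z" if "z \<in> points X" for z
      using covering_aut_proj[OF xy(1) covering_aut_points[OF xy(2) that]]
        covering_aut_proj[OF xy(2) that] that by (simp add: compose_eq)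
    ultimately show ?thesis
      unfolding covering_aut_iff mult by (intro conjI ballI compose_extensional)
  qed
  show "\<one>\<^bsub>?A\<^esub> \<in> carrier ?A"
    unfolding one
    by (rule covering_aut_I[OF X, where v = "\<lambda>x. x"]) (simp_all add: cont_graph_map_def graph_map_def)
  show "x \<otimes>\<^bsub>?A\<^esub> y \<otimes>\<^bsub>?A\<^esub> z = x \<otimes>\<^bsub>?A\<^esub> (y \<otimes>\<^bsub>?A\<^esub> z)"
    if "x \<in> carrier ?A" "y \<in> carrier ?A" "z \<in> carrier ?A" for x y z
    unfolding mult
    by (rule compose_assoc[symmetric]) (use covering_aut_points[OF that(3)] in blast)
  show "\<one>\<^bsub>?A\<^esub> \<otimes>\<^bsub>?A\<^esub> x = x" if x: "x \<in> carrier ?A" for x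
    unfolding mult one
    by (rule Id_compose[OF _ ext[OF x]]) (use covering_aut_points[OF x] in blast)
  show "\<exists>y\<in>carrier ?A. y \<otimes>\<^bsub>?A\<^esub> x = \<one>\<^bsub>?A\<^esub>" if x: "x \<in> carrier ?A" for x
  proof -
    obtain y where y: "y \<in> carrier ?A" "\<forall>z\<in>points X. y (x z) = z \<and> x (y z) = z"
      using covering_aut_inverse[OF X x] by (elim bexE)
    then have "y \<otimes>\<^bsub>?A\<^esub> x = \<one>\<^bsub>?A\<^esub>"
      unfolding mult one compose_def by (intro restrict_ext) simp
    with y(1) show ?thesis by blast
  qed
qed

lemma covering_aut_mult:
  "x \<in> points X \<Longrightarrow> (g \<otimes>\<^bsub>covering_aut X p\<^esub> g') x = g (g' x)"
  by (simp add: covering_aut_def compose_eq)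

lemma covering_aut_one: "x \<in> points X \<Longrightarrow> \<one>\<^bsub>covering_aut X p\<^esub> x = x"
  by (simp add: covering_aut_def)

lemma covering_aut_inv:
  assumes X: "profinite_graph X" and g: "g \<in> carrier (covering_aut X p)" and x: "x \<in> points X"
  shows "g ((inv\<^bsub>covering_aut X p\<^esub> g) x) = x"
proof -
  let ?A = "covering_aut X p"
  interpret group ?A by (rule covering_aut_group[OF X])
  show "g ((inv\<^bsub>?A\<^esub> g) x) = x"
    using covering_aut_mult[OF x, where p = p and g = g and g' = "inv\<^bsub>?A\<^esub> g"]
      covering_aut_one[OF x, where p = p]
    unfolding r_inv[OF g] by simp
qed


subsection \<open>The universal covering\<close>

lemma universal_coveringD:
  assumes "universal_covering U X Z p"
  shows "connected_profinite_graph Z" "connected_profinite_graph X" "covering X Z p"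
  using assms unfolding universal_covering_def connected_covering_def by blast+

lemma universal_covering_lift:
  fixes \<Gamma> :: "'u ugraph"
  assumes "universal_covering TYPE('u) X Z p" "covering \<Gamma> Z f" "connected_profinite_graph \<Gamma>"
    and "c \<in> verts X" "a \<in> verts \<Gamma>" "p c = f a"
  obtains h where "covering_hom X p \<Gamma> f h" "h c = a"
  using assms unfolding universal_covering_def connected_covering_def by blast

text \<open>\<open>v \<circ> u\<close> and the identity are both lifts of \<open>p\<close> through
  itself, and they agree at \<open>c\<close>.\<close>

lemma covering_hom_inverse:
  fixes X :: "('a, 'm) ugraph_scheme" and Z :: "('b, 'n) ugraph_scheme"
  assumes X: "connected_profinite_graph X" and p: "covering X Z p"
    and u: "covering_hom X p X p u" and v: "covering_hom X p X p v"
    and c: "c \<in> verts X" "v (u c) = c" and x: "x \<in> points X"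
  shows "v (u x) = x"
proof -
  obtain I :: "(nat + 'a + 'b) set" and rel and G :: "_ \<Rightarrow> nat graph" and D :: "_ \<Rightarrow> nat graph"
    and \<phi> \<psi> F a b where "covering_system X Z I rel G \<phi> a D \<psi> b p F"
    using coveringE[OF p] .
  then interpret covering_system X Z I rel G \<phi> a D \<psi> b p F .
  have u': "cont_graph_map X X u" and v': "cont_graph_map X X v"
    and pu: "\<And>z. z \<in> points X \<Longrightarrow> p (u z) = p z" and pv: "\<And>z. z \<in> points X \<Longrightarrow> p (v z) = p z"
    using u v by (simp_all add: covering_hom_def)
  have up: "u z \<in> points X" if "z \<in> points X" for z
    using u' that by (auto simp: cont_graph_map_def intro: graph_map_points)
  have "(v \<circ> u) x = (\<lambda>z. z) x"
  proof (rule unique_lift[OF X cont_graph_map_compose[OF u' v'] cont_graph_map_id _ c(1) _ x])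
    show "p ((v \<circ> u) z) = p z" if "z \<in> points X" for z
      using pv[OF up[OF that]] pu[OF that] by simp
    show "(v \<circ> u) c = c" using c(2) by simp
  qed
  then show ?thesis by simp
qed

text \<open>The universal property in both directions between two vertices of a fibre gives
  endomorphisms that undo each other at one vertex, hence everywhere. For edges one moves the
  source; an edge is determined by its source and its image under \<open>p\<close>.\<close>

lemma universal_covering_transitive:
  fixes X :: "'c ugraph" and Z :: "('b, 'n) ugraph_scheme"
  assumes univ: "universal_covering TYPE('c) X Z p"
    and xy: "x \<in> points X" "y \<in> points X" "p x = p y"
  shows "\<exists>g\<in>carrier (covering_aut X p). g x = y"
proof -
  note X = universal_coveringD(2)[OF univ] and p = universal_coveringD(3)[OF univ]
  obtain I :: "(nat + 'c + 'b) set" and rel and G :: "_ \<Rightarrow> nat graph" and D :: "_ \<Rightarrow> nat graph"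
    and \<phi> \<psi> F a b where "covering_system X Z I rel G \<phi> a D \<psi> b p F"
    using coveringE[OF p] .
  then interpret covering_system X Z I rel G \<phi> a D \<psi> b p F .
  have vert: "\<exists>g\<in>carrier (covering_aut X p). g c = d"
    if cd: "c \<in> verts X" "d \<in> verts X" "p c = p d" for c d
  proof -
    obtain u where u: "covering_hom X p X p u" "u c = d"
      using universal_covering_lift[OF univ p X cd] .
    obtain v where v: "covering_hom X p X p v" "v d = c"
      using universal_covering_lift[OF univ p X cd(2,1) cd(3)[symmetric]] .
    have vu: "v (u c) = c" and uv: "u (v d) = d" using u(2) v(2) by simp_all
    have "restrict u (points X) \<in> carrier (covering_aut X p)"
    proof (rule covering_aut_I[OF up.profinite])
      show "cont_graph_map X X u" "cont_graph_map X X v"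
        using u(1) v(1) by (simp_all add: covering_hom_def)
      show "u (v z) = z" if "z \<in> points X" for z
        by (rule covering_hom_inverse[OF X p v(1) u(1) cd(2) uv that])
      show "v (u z) = z" if "z \<in> points X" for z
        by (rule covering_hom_inverse[OF X p u(1) v(1) cd(1) vu that])
      show "p (u z) = p z" if "z \<in> points X" for z
        using u(1) that by (simp add: covering_hom_def)
    qed
    moreover have "restrict u (points X) c = d" using cd(1) u(2) by (simp add: points_def)
    ultimately show ?thesis by blast
  qed
  show ?thesis
  proof (cases "x \<in> verts X")
    case True
    then have "p y \<in> verts Z" using graph_map_verts[OF cover_graph_map True] xy(3) by simp
    then have "y \<in> verts X" by (rule graph_map_reflects_verts[OF cover_graph_map down_graph xy(2)])
    from vert[OF True this xy(3)] show ?thesis .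
  next
    case False
    with xy(1) have x: "x \<in> edges X" by (simp add: points_def)
    then have "p y \<in> edges Z" using graph_map_edges[OF cover_graph_map x] xy(3) by simp
    then have y: "y \<in> edges X" by (rule graph_map_reflects_edges[OF cover_graph_map down_graph xy(2)])
    have "p (src X x) = p (src X y)"
      using graph_map_src[OF cover_graph_map x] graph_map_src[OF cover_graph_map y] xy(3) by simp
    then obtain g where g: "g \<in> carrier (covering_aut X p)" "g (src X x) = src X y"
      using vert[OF graph_src[OF up_graph x] graph_src[OF up_graph y]] by blast
    have "g x = y"
    proof (rule locally_bijective_inj[OF cover_locally_bijective up_graph _ y])
      show "g x \<in> edges X" by (rule graph_map_edges[OF covering_aut_map[OF g(1)] x])
      show "src X (g x) = src X y" using graph_map_src[OF covering_aut_map[OF g(1)] x] g(2) by simp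
      show "p (g x) = p y" using covering_aut_proj[OF g(1) xy(1)] xy(3) by simp
    qed
    with g(1) show ?thesis by blast
  qed
qed

text \<open>The fibres are the orbits of a group of homeomorphisms.\<close>

lemma universal_covering_open_map:
  fixes X :: "'c ugraph" and Z :: "('b, 'n) ugraph_scheme"
  assumes univ: "universal_covering TYPE('c) X Z p"
  shows "open_map (graph_topology X) (graph_topology Z) p"
  unfolding open_map_def
proof (intro allI impI)
  note X = universal_coveringD(2)[OF univ] and p = universal_coveringD(3)[OF univ]
  obtain I :: "(nat + 'c + 'b) set" and rel and G :: "_ \<Rightarrow> nat graph" and D :: "_ \<Rightarrow> nat graph"
    and \<phi> \<psi> F a b where "covering_system X Z I rel G \<phi> a D \<psi> b p F"
    using coveringE[OF p] .
  then interpret covering_system X Z I rel G \<phi> a D \<psi> b p F .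
  note topX = profinite_topspace[OF up.profinite] and topZ = profinite_topspace[OF down.profinite]
  obtain c where c: "c \<in> verts X" using connected_profinite_has_vert[OF X] .
  have "p ` points X = points Z"
    by (rule cover_surj[OF universal_coveringD(1)[OF univ] c])
  \<comment> \<open>A continuous surjection from a compact space to a Hausdorff space is a quotient
    map, so openness of an image can be tested on its preimage.\<close>
  then have quot: "quotient_map (graph_topology X) (graph_topology Z) p"
    using cont by (intro T1_Spaces.continuous_imp_quotient_map[OF _
      profinite_compact[OF up.profinite] profinite_Hausdorff[OF down.profinite]])
      (simp_all add: cont_graph_map_def topX topZ)
  fix U assume U: "openin (graph_topology X) U"
  then have UX: "U \<subseteq> points X" using openin_subset topX by blast
  \<comment> \<open>The saturation of \<open>U\<close> is the union of its translates, each of which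
    is open.\<close>
  have "{x \<in> points X. p x \<in> p ` U} = (\<Union>g\<in>carrier (covering_aut X p). g ` U)"
  proof (intro equalityI subsetI)
    fix x assume "x \<in> {x \<in> points X. p x \<in> p ` U}"
    then obtain y where y: "x \<in> points X" "y \<in> U" "p x = p y" by blast
    then have "y \<in> points X" using UX by blast
    from universal_covering_transitive[OF univ this y(1) y(3)[symmetric]] y(2)
    show "x \<in> (\<Union>g\<in>carrier (covering_aut X p). g ` U)" by blast
  next
    fix x assume "x \<in> (\<Union>g\<in>carrier (covering_aut X p). g ` U)"
    then obtain g y where g: "g \<in> carrier (covering_aut X p)" "y \<in> U" "x = g y" by blast
    then have "y \<in> points X" using UX by blast
    then have "x \<in> points X" "p x = p y"
      using covering_aut_points[OF g(1)] covering_aut_proj[OF g(1)] g(3) by simp_all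
    with g(2) show "x \<in> {x \<in> points X. p x \<in> p ` U}" by blast
  qed
  moreover have "openin (graph_topology X) (\<Union>g\<in>carrier (covering_aut X p). g ` U)"
  proof (rule openin_Union)
    fix V assume "V \<in> (\<lambda>g. g ` U) ` carrier (covering_aut X p)"
    then obtain g where g: "g \<in> carrier (covering_aut X p)" "V = g ` U" by blast
    show "openin (graph_topology X) V"
      using homeomorphic_imp_open_map[OF covering_aut_homeo[OF g(1)]] U g(2)
      by (simp add: open_map_def)
  qed
  ultimately have "openin (graph_topology X) {x \<in> topspace (graph_topology X). p x \<in> p ` U}"
    by (simp add: topX)
  moreover have "p ` U \<subseteq> topspace (graph_topology Z)"
    using UX graph_map_points[OF cover_graph_map] topZ by blast
  ultimately show "openin (graph_topology Z) (p ` U)"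
    using quot unfolding quotient_map_def by blast
qed

text \<open>At each finite level, the points of \<open>Y\<close> that agree with the image of \<open>h\<close> form a clopen
  set that is closed under passing along edges. Openness holds because \<open>p\<close> is open.\<close>

lemma universal_covering_lift_surj:
  fixes X :: "'c ugraph" and Y :: "('a, 'm) ugraph_scheme" and Z :: "('b, 'n) ugraph_scheme"
  assumes univ: "universal_covering TYPE('c) X Z p"
    and Y: "connected_profinite_graph Y" and f: "covering Y Z f" and h: "covering_hom X p Y f h"
  shows "h ` points X = points Y"
proof -
  note X = universal_coveringD(2)[OF univ] and p = universal_coveringD(3)[OF univ]
  obtain J :: "(nat + 'c + 'b) set" and rel' and G' :: "_ \<Rightarrow> nat graph" and D' :: "_ \<Rightarrow> nat graph"
    and \<phi>' \<psi>' F' a' b' where "covering_system X Z J rel' G' \<phi>' a' D' \<psi>' b' p F'"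
    using coveringE[OF p] .
  then interpret P: covering_system X Z J rel' G' \<phi>' a' D' \<psi>' b' p F' .
  obtain I :: "(nat + 'a + 'b) set" and rel and G :: "_ \<Rightarrow> nat graph" and D :: "_ \<Rightarrow> nat graph"
    and \<phi> \<psi> F a b where "covering_system Y Z I rel G \<phi> a D \<psi> b f F"
    using coveringE[OF f] .
  then interpret C: covering_system Y Z I rel G \<phi> a D \<psi> b f F .
  note topX = profinite_topspace[OF P.up.profinite] and topY = profinite_topspace[OF C.up.profinite]
    and topZ = profinite_topspace[OF C.down.profinite]
  have hcont: "continuous_map (graph_topology X) (graph_topology Y) h" and hmap: "graph_map X Y h"
    and fh: "\<And>x. x \<in> points X \<Longrightarrow> f (h x) = p x"
    using h by (simp_all add: covering_hom_def cont_graph_map_def)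
  have pcont: "continuous_map (graph_topology X) (graph_topology Z) p"
    using P.cont by (simp add: cont_graph_map_def)
  have fcont: "continuous_map (graph_topology Y) (graph_topology Z) f"
    using C.cont by (simp add: cont_graph_map_def)
  have closed: "closed_map (graph_topology X) (graph_topology Z) p"
    by (rule continuous_imp_closed_map[OF pcont profinite_compact[OF P.up.profinite]
      profinite_Hausdorff[OF C.down.profinite]])
  have ucont: "continuous_map (graph_topology X) (discrete_topology UNIV) (\<lambda>x. a (h x) i)"
    if "i \<in> I" for i
    using continuous_map_compose[OF hcont C.up.coord_continuous[OF that]] by (simp add: o_def)
  obtain c where c: "c \<in> verts X" using connected_profinite_has_vert[OF X] .
  \<comment> \<open>Only the coordinate of \<open>h x\<close> is approximated. That \<open>x\<close>
    lies exactly over \<open>f y\<close> is what allows the edge \<open>f e\<close> to be lifted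
    through \<open>p\<close> at \<open>x\<close> in the induction.\<close>
  have level: "\<exists>x\<in>points X. p x = f y \<and> a (h x) i = a y i" if i: "i \<in> I" and y: "y \<in> verts Y" for i y
  proof -
    define S where "S = {y \<in> points Y. \<exists>x\<in>points X. p x = f y \<and> a (h x) i = a y i}"
    define B where "B t = {x \<in> points X. a (h x) i = t}" for t
    define E where "E t = {y \<in> points Y. a y i = t} \<inter> {y \<in> points Y. f y \<in> p ` B t}" for t
    have B: "openin (graph_topology X) (B t)" "closedin (graph_topology X) (B t)" for t
      using clopen_locally_constant1[OF ucont[OF i], of "\<lambda>s. s = t"] by (simp_all add: B_def topX)
    have Y_level: "openin (graph_topology Y) {y \<in> points Y. a y i = t}"
      "closedin (graph_topology Y) {y \<in> points Y. a y i = t}" for t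
      using clopen_locally_constant1[OF C.up.coord_continuous[OF i], of "\<lambda>s. s = t"]
      by (simp_all add: topY)
    have "openin (graph_topology Z) (p ` B t)" for t
      using universal_covering_open_map[OF univ] B(1) unfolding open_map_def by blast
    then have E_open: "openin (graph_topology Y) (E t)" for t
      unfolding E_def
      using openin_continuous_map_preimage[OF fcont, of "p ` B t"] Y_level(1)[of t]
      by (intro openin_Int) (simp_all add: topY)
    have "closedin (graph_topology Z) (p ` B t)" for t
      using closed B(2) unfolding closed_map_def by blast
    then have E_closed: "closedin (graph_topology Y) (E t)" for t
      unfolding E_def
      using closedin_continuous_map_preimage[OF fcont, of "p ` B t"] Y_level(2)[of t]
      by (intro closedin_Int) (simp_all add: topY)
    \<comment> \<open>Level \<open>i\<close> is finite, so this is a finite union and closedness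
      survives.\<close>
    have S_eq: "S = \<Union>(E ` points (G i))"
    proof (intro equalityI subsetI)
      fix z assume "z \<in> S"
      then obtain x where x: "z \<in> points Y" "x \<in> points X" "p x = f z" "a (h x) i = a z i"
        unfolding S_def by blast
      then have "x \<in> B (a z i)" by (simp add: B_def)
      then have "f z \<in> p ` B (a z i)" using x(3) by (metis imageI)
      then have "z \<in> E (a z i)" using x(1) by (simp add: E_def)
      then show "z \<in> \<Union>(E ` points (G i))" using C.up.coord_points[OF x(1) i] by blast
    next
      fix z assume "z \<in> \<Union>(E ` points (G i))"
      then obtain t where t: "z \<in> points Y" "a z i = t" "f z \<in> p ` B t" unfolding E_def by blast
      then obtain x where "x \<in> points X" "a (h x) i = t" "f z = p x" unfolding B_def by blast
      with t show "z \<in> S" unfolding S_def by auto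
    qed
    have "y \<in> S"
    proof (rule connected_profinite_clopen_induct[OF Y _ _ _ _ _ y])
      show "openin (graph_topology Y) S" unfolding S_eq using E_open by (intro openin_Union) blast
      show "closedin (graph_topology Y) S"
        unfolding S_eq using E_closed C.up.level_finite[OF i] by (intro closedin_Union) auto
      show hc: "h c \<in> verts Y" by (rule graph_map_verts[OF hmap c])
      have "c \<in> points X" using c by (simp add: points_def)
      moreover have "h c \<in> points Y" using hc by (simp add: points_def)
      moreover have "p c = f (h c)" using fh[OF \<open>c \<in> points X\<close>] by simp
      ultimately show "h c \<in> S" unfolding S_def by blast
      fix e assume e: "e \<in> edges Y" "src Y e \<in> S"
      then obtain x where x: "x \<in> points X" "p x = f (src Y e)" "a (h x) i = a (src Y e) i"
        unfolding S_def by blast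
      have ep: "e \<in> points Y" using e(1) by (simp add: points_def)
      have fe: "f e \<in> edges Z" "src Z (f e) = p x"
        using graph_map_edges[OF C.cover_graph_map e(1)] graph_map_src[OF C.cover_graph_map e(1)] x(2)
        by simp_all
      have "p x \<in> verts Z" using graph_src[OF C.down_graph fe(1)] fe(2) by simp
      then have xv: "x \<in> verts X"
        by (rule graph_map_reflects_verts[OF P.cover_graph_map C.down_graph x(1)])
      obtain e' where e': "e' \<in> edges X" "src X e' = x" "p e' = f e"
        using locally_bijective_lift[OF P.cover_locally_bijective xv fe] .
      have e'p: "e' \<in> points X" "h e' \<in> edges Y" "h e' \<in> points Y"
        using e'(1) graph_map_edges[OF hmap e'(1)] by (simp_all add: points_def)
      note g = C.up.coord_graph_map[OF i]
      \<comment> \<open>The two edges at level \<open>i\<close> have the same source by the choice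
        of \<open>x\<close> and the same image in \<open>D i\<close>, so they coincide.\<close>
      have eq: "a (h e') i = a e i"
      proof (rule locally_bijective_inj[OF C.level_bij[OF i] C.up.level_graph[OF i]
            graph_map_edges[OF g e'p(2)] graph_map_edges[OF g e(1)]])
        show "src (G i) (a (h e') i) = src (G i) (a e i)"
          using graph_map_src[OF g e'p(2)] graph_map_src[OF g e(1)] graph_map_src[OF hmap e'(1)]
            e'(2) x(3) by simp
        show "F i (a (h e') i) = F i (a e i)"
          using C.coord[OF e'p(3) i] C.coord[OF ep i] fh[OF e'p(1)] e'(3) by simp
      qed
      have "tgt X e' \<in> points X" "tgt Y e \<in> points Y"
        using graph_tgt[OF P.up_graph e'(1)] graph_tgt[OF C.up_graph e(1)] by (simp_all add: points_def)
      moreover have "p (tgt X e') = f (tgt Y e)"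
        using graph_map_tgt[OF P.cover_graph_map e'(1)] graph_map_tgt[OF C.cover_graph_map e(1)] e'(3)
        by simp
      moreover have "a (h (tgt X e')) i = a (tgt Y e) i"
        using graph_map_tgt[OF hmap e'(1)] graph_map_tgt[OF g e'p(2)] graph_map_tgt[OF g e(1)] eq
        by simp
      ultimately show "tgt Y e \<in> S" unfolding S_def by blast
    qed
    then show ?thesis unfolding S_def by blast
  qed
  have vert: "\<exists>x\<in>points X. h x = y" if y: "y \<in> verts Y" for y
  proof -
    have yp: "y \<in> points Y" using y by (simp add: points_def)
    \<comment> \<open>The approximate solutions at level \<open>i\<close>. They are closed and
      shrink along the directed index set, so compactness yields a point that is right at all
      levels.\<close>
    define C' where "C' i = {x \<in> points X. p x = f y \<and> a (h x) i = a y i}" for i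
    have fy: "f y \<in> points Z" by (rule graph_map_points[OF C.cover_graph_map yp])
    have "closedin (graph_topology Z) {f y}"
      by (rule closedin_Hausdorff_singleton[OF profinite_Hausdorff[OF C.down.profinite]])
        (simp add: topZ fy)
    from closedin_continuous_map_preimage[OF pcont this]
    have fibre: "closedin (graph_topology X) {x \<in> points X. p x = f y}" by (simp add: topX)
    have closed': "closedin (graph_topology X) (C' i)" if "i \<in> I" for i
    proof -
      have "C' i = {x \<in> points X. p x = f y} \<inter> {x \<in> points X. a (h x) i = a y i}"
        unfolding C'_def by blast
      moreover have "closedin (graph_topology X) {x \<in> points X. a (h x) i = a y i}"
        using clopen_locally_constant1(2)[OF ucont[OF that], of "\<lambda>s. s = a y i"] by (simp add: topX)
      ultimately show ?thesis using fibre by (simp add: closedin_Int)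
    qed
    have ne: "C' i \<noteq> {}" if "i \<in> I" for i using level[OF that y] unfolding C'_def by blast
    have mono: "C' j \<subseteq> C' i" if ij: "i \<in> I" "j \<in> I" "rel i j" for i j
    proof
      fix x assume x: "x \<in> C' j"
      then have "h x \<in> points Y" using graph_map_points[OF hmap] unfolding C'_def by blast
      then have "a (h x) i = a y i"
        using C.up.coord_transition[OF _ ij, of "h x"] C.up.coord_transition[OF yp ij] x
        by (simp add: C'_def)
      with x show "x \<in> C' i" by (simp add: C'_def)
    qed
    obtain x where x: "\<forall>i\<in>I. x \<in> C' i"
    proof (rule compact_space_directed_Inter[where C = C', OF profinite_compact[OF P.up.profinite]
          C.up.directed closed' ne mono])
      fix x assume "x \<in> topspace (graph_topology X)" "\<And>i. i \<in> I \<Longrightarrow> x \<in> C' i"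
      then show thesis using that by blast
    qed
    obtain i0 where i0: "i0 \<in> I" using C.up.index_nonempty by blast
    then have xp: "x \<in> points X" using x by (simp add: C'_def)
    have "h x = y"
    proof (rule C.up.coord_eqI[OF graph_map_points[OF hmap xp] yp])
      show "a (h x) i = a y i" if "i \<in> I" for i using x that by (simp add: C'_def)
    qed
    with xp show ?thesis by blast
  qed
  show ?thesis
  proof (intro equalityI subsetI)
    fix y assume "y \<in> h ` points X"
    then show "y \<in> points Y" using graph_map_points[OF hmap] by blast
  next
    fix y assume yp: "y \<in> points Y"
    show "y \<in> h ` points X"
    proof (cases "y \<in> verts Y")
      case True
      from vert[OF this] show ?thesis by blast
    next
      case False
      with yp have y: "y \<in> edges Y" by (simp add: points_def)
      \<comment> \<open>Lift \<open>f y\<close> through \<open>p\<close> at a preimage of the source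
        of \<open>y\<close>. The image of this lift under \<open>h\<close> shares source and
        projection with \<open>y\<close>, hence equals it.\<close>
      have sy: "src Y y \<in> verts Y" by (rule graph_src[OF C.up_graph y])
      obtain x where x: "x \<in> points X" "h x = src Y y" using vert[OF sy] by blast
      have "x \<in> verts X"
        by (rule graph_map_reflects_verts[OF hmap C.up_graph x(1)]) (simp add: x(2) sy)
      moreover have "f y \<in> edges Z" "src Z (f y) = p x"
        using graph_map_edges[OF C.cover_graph_map y] graph_map_src[OF C.cover_graph_map y]
          fh[OF x(1)] x(2) by simp_all
      ultimately obtain e where e: "e \<in> edges X" "src X e = x" "p e = f y"
        by (rule locally_bijective_lift[OF P.cover_locally_bijective])
      have ep: "e \<in> points X" using e(1) by (simp add: points_def)
      have "h e = y"
      proof (rule locally_bijective_inj[OF C.cover_locally_bijective C.up_graph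
            graph_map_edges[OF hmap e(1)] y])
        show "src Y (h e) = src Y y" using graph_map_src[OF hmap e(1)] e(2) x(2) by simp
        show "f (h e) = f y" using fh[OF ep] e(3) by simp
      qed
      with ep show ?thesis by blast
    qed
  qed
qed


subsection \<open>Stabilizers of lifts\<close>

text \<open>By uniqueness of lifts only finitely many maps \<open>u \<circ> g\<close> occur, since each is determined by its
  value at one vertex. Hence the intersection of their kernels is an entourage.\<close>

lemma invariant_entourage_kernel:
  assumes X: "connected_profinite_graph X"
    and G: "is_graph G" "finite (points G)" and F: "locally_bijective G D F"
    and u: "graph_map X G u" "continuous_map (graph_topology X) (discrete_topology UNIV) u"
    and lift: "\<And>x. x \<in> points X \<Longrightarrow> F (u x) = d (p x)"
  shows "invariant_entourage X p
    {(x, y) \<in> points X \<times> points X. \<forall>g\<in>carrier (covering_aut X p). u (g x) = u (g y)}"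
    (is "invariant_entourage X p ?R")
proof -
  have P: "profinite_graph X" using X by (simp add: connected_profinite_graph_def)
  let ?A = "covering_aut X p"
  interpret A: group ?A by (rule covering_aut_group[OF P])
  note gr = profinite_is_graph[OF P]
  obtain c where c: "c \<in> verts X" using connected_profinite_has_vert[OF X] .
  have cp: "c \<in> points X" using c by (simp add: points_def)
  \<comment> \<open>Restriction to the graph makes equality on points equality of functions, so that
    finiteness of this set says that only finitely many composites occur.\<close>
  define \<F> where "\<F> = (\<lambda>g. restrict (\<lambda>x. u (g x)) (points X)) ` carrier ?A"
  have ug: "graph_map X G (\<lambda>x. u (g x))"
    "continuous_map (graph_topology X) (discrete_topology UNIV) (\<lambda>x. u (g x))"
    if g: "g \<in> carrier ?A" for g
    using graph_map_compose[OF covering_aut_map[OF g] u(1)]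
      continuous_map_compose[OF homeomorphic_imp_continuous_map[OF covering_aut_homeo[OF g]] u(2)]
    by (simp_all add: o_def)
  have lift_g: "F (u (g x)) = d (p x)" if "g \<in> carrier ?A" "x \<in> points X" for g x
    using lift[OF covering_aut_points[OF that]] covering_aut_proj[OF that] by simp
  have "inj_on (\<lambda>\<phi>. \<phi> c) \<F>"
  proof (rule inj_onI)
    fix \<phi> \<psi> assume "\<phi> \<in> \<F>" "\<psi> \<in> \<F>" and eq: "\<phi> c = \<psi> c"
    then obtain g k where g: "g \<in> carrier ?A" "\<phi> = restrict (\<lambda>x. u (g x)) (points X)"
      and k: "k \<in> carrier ?A" "\<psi> = restrict (\<lambda>x. u (k x)) (points X)"
      unfolding \<F>_def by blast
    have uc: "u (g c) = u (k c)" using eq cp g(2) k(2) by simp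
    have "u (g x) = u (k x)" if x: "x \<in> points X" for x
    proof (rule locally_constant_unique_lift[OF X ug[OF g(1)] ug[OF k(1)] G(1) F _ c uc x])
      show "F (u (g y)) = F (u (k y))" if "y \<in> points X" for y
        using lift_g[OF g(1) that] lift_g[OF k(1) that] by simp
    qed
    then show "\<phi> = \<psi>" unfolding g(2) k(2) by (intro restrict_ext)
  qed
  moreover have "(\<lambda>\<phi>. \<phi> c) ` \<F> \<subseteq> points G"
  proof
    fix t assume "t \<in> (\<lambda>\<phi>. \<phi> c) ` \<F>"
    then obtain g where g: "g \<in> carrier ?A" "t = u (g c)" using cp unfolding \<F>_def by auto
    show "t \<in> points G" unfolding g(2) by (rule graph_map_points[OF ug(1)[OF g(1)] cp])
  qed
  ultimately have finF: "finite \<F>" using G(2) by (metis finite_subset finite_imageD)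
  have neF: "\<F> \<noteq> {}" unfolding \<F>_def using A.one_closed by blast
  have F_iff: "(\<forall>\<phi>\<in>\<F>. \<phi> x = \<phi> y) \<longleftrightarrow> (\<forall>g\<in>carrier ?A. u (g x) = u (g y))"
    if "x \<in> points X" "y \<in> points X" for x y
    using that by (simp add: \<F>_def)
  have ker: "{(x, y) \<in> points X \<times> points X. \<phi> x = \<phi> y} \<in> entourages X" if \<phi>: "\<phi> \<in> \<F>" for \<phi>
  proof -
    obtain g where g: "g \<in> carrier ?A" "\<phi> = restrict (\<lambda>x. u (g x)) (points X)"
      using \<phi> unfolding \<F>_def by blast
    have "continuous_map (graph_topology X) (discrete_topology UNIV) \<phi>"
      by (rule continuous_map_eq[OF ug(2)[OF g(1)]]) (simp add: g(2) profinite_topspace[OF P])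
    then show ?thesis by (rule kernel_entourage[OF P])
  qed
  have R_eq: "?R = {(x, y) \<in> points X \<times> points X. \<forall>\<phi>\<in>\<F>. \<phi> x = \<phi> y}"
    by (rule Collect_cong) (simp add: F_iff split: prod.split cong: conj_cong)
  have R_Inter: "?R = (\<Inter>\<phi>\<in>\<F>. {(x, y) \<in> points X \<times> points X. \<phi> x = \<phi> y})"
    unfolding R_eq using neF by blast
  have ent: "?R \<in> entourages X"
    unfolding R_Inter using finF neF ker
    by (intro finite_Inter_entourages[OF profinite_uniformity[OF P]]) auto
  \<comment> \<open>All values are packed into one map with finite image, whose kernel is the
    relation; this gives the finite number of classes.\<close>
  define U where "U x = restrict (\<lambda>\<phi>. \<phi> x) \<F>" for x
  have U_iff: "U x = U y \<longleftrightarrow> (\<forall>\<phi>\<in>\<F>. \<phi> x = \<phi> y)" for x y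
  proof
    assume eq: "U x = U y"
    show "\<forall>\<phi>\<in>\<F>. \<phi> x = \<phi> y"
    proof
      fix \<phi> assume "\<phi> \<in> \<F>"
      then show "\<phi> x = \<phi> y" using fun_cong[OF eq, of \<phi>] by (simp only: U_def restrict_apply')
    qed
  next
    assume "\<forall>\<phi>\<in>\<F>. \<phi> x = \<phi> y"
    then show "U x = U y" unfolding U_def by (intro restrict_ext) blast
  qed
  have R_ker: "?R = {(x, y) \<in> points X \<times> points X. U x = U y}"
    unfolding R_eq U_iff ..
  have "U ` points X \<subseteq> Pi\<^sub>E \<F> (\<lambda>_. points G)"
  proof
    fix s assume "s \<in> U ` points X"
    then obtain x where x: "x \<in> points X" "s = U x" by blast
    have "\<phi> x \<in> points G" if \<phi>: "\<phi> \<in> \<F>" for \<phi>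
    proof -
      obtain g where g: "g \<in> carrier ?A" "\<phi> = restrict (\<lambda>x. u (g x)) (points X)"
        using \<phi> unfolding \<F>_def by blast
      show ?thesis
        using graph_map_points[OF ug(1)[OF g(1)] x(1)] by (simp only: g(2) restrict_apply'[OF x(1)])
    qed
    then show "s \<in> Pi\<^sub>E \<F> (\<lambda>_. points G)" by (simp add: x(2) U_def)
  qed
  then have "finite (U ` points X)"
    by (rule finite_subset) (simp add: finF G(2) finite_PiE)
  then have fin: "finite (points X // ?R)" unfolding R_ker by (rule finite_quotient_kernel)
  have at: "u (g x) = u (g y)" if "(x, y) \<in> ?R" "g \<in> carrier ?A" for x y g
    using that by blast
  have "compatible_equiv X ?R"
    unfolding compatible_equiv_def
  proof (intro conjI ballI impI)
    show "equiv (points X) ?R" unfolding R_ker by (rule kernel_equiv)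
  next
    fix v e assume v: "v \<in> verts X" and e: "e \<in> edges X"
    \<comment> \<open>The identity automorphism puts \<open>u\<close> itself into the family, and
      \<open>u\<close> tells vertices from edges.\<close>
    have "u (\<one>\<^bsub>?A\<^esub> v) \<in> verts G" "u (\<one>\<^bsub>?A\<^esub> e) \<in> edges G"
      using graph_map_verts[OF ug(1)[OF A.one_closed] v] graph_map_edges[OF ug(1)[OF A.one_closed] e] .
    then show "(v, e) \<notin> ?R" using at[OF _ A.one_closed, of v e] graph_disjoint[OF G(1)] by metis
  next
    fix e e' assume e: "e \<in> edges X" "e' \<in> edges X" and R: "(e, e') \<in> ?R"
    have "u (g (src X e)) = u (g (src X e'))" "u (g (tgt X e)) = u (g (tgt X e'))"
      "u (g (rev_edge X e)) = u (g (rev_edge X e'))" if g: "g \<in> carrier ?A" for g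
      using at[OF R g] graph_map_src[OF ug(1)[OF g] e(1)] graph_map_src[OF ug(1)[OF g] e(2)]
        graph_map_tgt[OF ug(1)[OF g] e(1)] graph_map_tgt[OF ug(1)[OF g] e(2)]
        graph_map_rev[OF ug(1)[OF g] e(1)] graph_map_rev[OF ug(1)[OF g] e(2)] by simp_all
    moreover have "src X e \<in> points X" "src X e' \<in> points X" "tgt X e \<in> points X" "tgt X e' \<in> points X"
      "rev_edge X e \<in> points X" "rev_edge X e' \<in> points X"
      using e graph_src[OF gr] graph_tgt[OF gr] graph_rev[OF gr] by (simp_all add: points_def)
    ultimately show "(src X e, src X e') \<in> ?R" "(tgt X e, tgt X e') \<in> ?R"
      "(rev_edge X e, rev_edge X e') \<in> ?R" by blast+
  next
    fix e assume e: "e \<in> edges X"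
    have "u (\<one>\<^bsub>?A\<^esub> (rev_edge X e)) \<noteq> u (\<one>\<^bsub>?A\<^esub> e)"
      using graph_map_rev[OF ug(1)[OF A.one_closed] e]
        graph_rev_neq[OF G(1) graph_map_edges[OF ug(1)[OF A.one_closed] e]] by simp
    then show "(e, rev_edge X e) \<notin> ?R" using at[OF _ A.one_closed, of e "rev_edge X e"] by metis
  qed
  moreover have "map_prod g g ` ?R = ?R" if g: "g \<in> carrier ?A" for g
  proof
    \<comment> \<open>Precomposition with \<open>k\<close> sends the family of maps
      \<open>u \<circ> g\<close> into itself. Equality of the image with the relation then uses the
      inverse as well.\<close>
    have stable: "(k x, k y) \<in> ?R" if k: "k \<in> carrier ?A" and R: "(x, y) \<in> ?R" for k x y
    proof -
      have xy: "x \<in> points X" "y \<in> points X" using R by blast+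
      have "u (g' (k x)) = u (g' (k y))" if g': "g' \<in> carrier ?A" for g'
        using at[OF R A.m_closed[OF g' k]]
        by (simp only: covering_aut_mult[OF xy(1)] covering_aut_mult[OF xy(2)])
      then show ?thesis using covering_aut_points[OF k xy(1)] covering_aut_points[OF k xy(2)] by blast
    qed
    show "map_prod g g ` ?R \<subseteq> ?R"
    proof
      fix s assume "s \<in> map_prod g g ` ?R"
      then obtain x y where xy: "(x, y) \<in> ?R" "s = (g x, g y)" by force
      show "s \<in> ?R" unfolding xy(2) by (rule stable[OF g xy(1)])
    qed
    show "?R \<subseteq> map_prod g g ` ?R"
    proof (rule subrelI)
      fix x y assume R: "(x, y) \<in> ?R"
      then have xy: "x \<in> points X" "y \<in> points X" by blast+
      let ?i = "inv\<^bsub>?A\<^esub> g"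
      have "(?i x, ?i y) \<in> ?R" by (rule stable[OF A.inv_closed[OF g] R])
      then have "map_prod g g (?i x, ?i y) \<in> map_prod g g ` ?R" by (rule imageI)
      then show "(x, y) \<in> map_prod g g ` ?R"
        by (simp only: map_prod_simp covering_aut_inv[OF P g xy(1)] covering_aut_inv[OF P g xy(2)])
    qed
  qed
  ultimately show ?thesis
    using ent fin unfolding invariant_entourage_def compatible_cofinite_entourage_def by blast
qed

text \<open>If \<open>h (g x)\<close> differs from \<open>h x\<close>, some coordinate already shows
  it. An element \<open>n\<close> close to the identity leaves that coordinate of
  \<open>h (g (n x))\<close> equal to the one of \<open>h (g x)\<close>, so the whole coset of such
  \<open>n\<close> stays outside the stabilizer.\<close>

lemma stabilizer_closed:
  fixes X :: "('c, 'l) ugraph_scheme" and Y :: "('a, 'm) ugraph_scheme" and Z :: "('b, 'n) ugraph_scheme"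
  assumes X: "connected_profinite_graph X" and f: "covering Y Z f" and h: "covering_hom X p Y f h"
  shows "closedin (aut_topology X p) {g \<in> carrier (covering_aut X p). \<forall>x\<in>points X. h (g x) = h x}"
    (is "closedin _ ?H")
proof -
  have P: "profinite_graph X" using X by (simp add: connected_profinite_graph_def)
  let ?A = "covering_aut X p"
  interpret A: group ?A by (rule covering_aut_group[OF P])
  note open_iff = openin_aut_topology[OF profinite_uniformity[OF P], of p]
  obtain I :: "(nat + 'a + 'b) set" and rel and G :: "_ \<Rightarrow> nat graph" and D :: "_ \<Rightarrow> nat graph"
    and \<phi> \<psi> F a b where "covering_system Y Z I rel G \<phi> a D \<psi> b f F"
    using coveringE[OF f] .
  then interpret C: covering_system Y Z I rel G \<phi> a D \<psi> b f F .
  have hcont: "continuous_map (graph_topology X) (graph_topology Y) h" and hmap: "graph_map X Y h"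
    and fh: "\<And>x. x \<in> points X \<Longrightarrow> f (h x) = p x"
    using h by (simp_all add: covering_hom_def cont_graph_map_def)
  \<comment> \<open>Quantifying over all \<open>g\<close> makes the entourage invariant, and it also
    covers the automorphism that translates the neighbourhood below.\<close>
  define R where "R i = {(x, y) \<in> points X \<times> points X. \<forall>g\<in>carrier ?A. a (h (g x)) i = a (h (g y)) i}"
    for i
  have inv: "invariant_entourage X p (R i)" if i: "i \<in> I" for i
    unfolding R_def
  proof (rule invariant_entourage_kernel[OF X C.up.level_graph[OF i] C.up.level_finite[OF i]
        C.level_bij[OF i]])
    show "graph_map X (G i) (\<lambda>x. a (h x) i)"
      using graph_map_compose[OF hmap C.up.coord_graph_map[OF i]] by (simp add: o_def)
    show "continuous_map (graph_topology X) (discrete_topology UNIV) (\<lambda>x. a (h x) i)"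
      using continuous_map_compose[OF hcont C.up.coord_continuous[OF i]] by (simp add: o_def)
    show "F i (a (h x) i) = b (p x) i" if "x \<in> points X" for x
      using C.coord[OF graph_map_points[OF hmap that] i] fh[OF that] by simp
  qed
  have coset: "g <#\<^bsub>?A\<^esub> aut_nbhd X p (R i) \<subseteq> carrier ?A" if "g \<in> carrier ?A" for g i
    using that A.m_closed unfolding l_coset_def aut_nbhd_def by blast
  obtain i0 where i0: "i0 \<in> I" using C.up.index_nonempty by blast
  \<comment> \<open>This identifies the underlying set of the group topology; any level provides the
    invariant entourage that it takes.\<close>
  have "openin (aut_topology X p) (carrier ?A)"
    unfolding open_iff using inv[OF i0] coset by blast
  moreover have "topspace (aut_topology X p) \<subseteq> carrier ?A"
    using openin_topspace[of "aut_topology X p"] unfolding open_iff by (rule conjunct1)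
  ultimately have top: "topspace (aut_topology X p) = carrier ?A"
    using openin_subset by blast
  have "openin (aut_topology X p) (carrier ?A - ?H)"
    unfolding open_iff
  proof (intro conjI ballI)
    fix g assume g: "g \<in> carrier ?A - ?H"
    then obtain x where x: "x \<in> points X" "h (g x) \<noteq> h x" by blast
    have gc: "g \<in> carrier ?A" using g by blast
    obtain i where i: "i \<in> I" "a (h (g x)) i \<noteq> a (h x) i"
      using C.up.coord_eqI[OF graph_map_points[OF hmap covering_aut_points[OF gc x(1)]]
        graph_map_points[OF hmap x(1)]] x(2) by blast
    have "g <#\<^bsub>?A\<^esub> aut_nbhd X p (R i) \<subseteq> carrier ?A - ?H"
    proof
      fix k assume k: "k \<in> g <#\<^bsub>?A\<^esub> aut_nbhd X p (R i)"
      then obtain n where n: "n \<in> carrier ?A" "\<forall>x\<in>points X. (n x, x) \<in> R i" "k = g \<otimes>\<^bsub>?A\<^esub> n"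
        unfolding l_coset_def aut_nbhd_def by blast
      have "(n x, x) \<in> R i" using n(2) x(1) by blast
      then have "a (h (g (n x))) i = a (h (g x)) i" using gc unfolding R_def by blast
      then have "h (k x) \<noteq> h x"
        unfolding n(3) covering_aut_mult[OF x(1)] using i(2) by metis
      then show "k \<in> carrier ?A - ?H" using k coset[OF gc] x(1) by blast
    qed
    then show "\<exists>R. invariant_entourage X p R \<and> g <#\<^bsub>?A\<^esub> aut_nbhd X p R \<subseteq> carrier ?A - ?H"
      using inv[OF i(1)] by blast
  qed blast
  then show ?thesis by (auto simp: closedin_def top)
qed

lemma stabilizer_subgroup:
  assumes P: "profinite_graph X"
  shows "subgroup {g \<in> carrier (covering_aut X p). \<forall>x\<in>points X. h (g x) = h x} (covering_aut X p)"
    (is "subgroup ?H ?A")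
proof -
  interpret A: group ?A by (rule covering_aut_group[OF P])
  show ?thesis
  proof (rule A.subgroupI)
    show "?H \<subseteq> carrier ?A" by blast
    have "h (\<one>\<^bsub>?A\<^esub> x) = h x" if "x \<in> points X" for x
      by (simp only: covering_aut_one[OF that])
    then show "?H \<noteq> {}" using A.one_closed by blast
    fix g assume "g \<in> ?H"
    then have g: "g \<in> carrier ?A" "\<And>x. x \<in> points X \<Longrightarrow> h (g x) = h x" by blast+
    have "h ((inv\<^bsub>?A\<^esub> g) x) = h x" if x: "x \<in> points X" for x
      using g(2)[OF covering_aut_points[OF A.inv_closed[OF g(1)] x]]
      by (simp only: covering_aut_inv[OF P g(1) x])
    then show "inv\<^bsub>?A\<^esub> g \<in> ?H" using A.inv_closed[OF g(1)] by blast
    fix k assume "k \<in> ?H"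
    then have k: "k \<in> carrier ?A" "\<And>x. x \<in> points X \<Longrightarrow> h (k x) = h x" by blast+
    have "h ((g \<otimes>\<^bsub>?A\<^esub> k) x) = h x" if x: "x \<in> points X" for x
      using g(2)[OF covering_aut_points[OF k(1) x]] k(2)[OF x]
      by (simp only: covering_aut_mult[OF x])
    then show "g \<otimes>\<^bsub>?A\<^esub> k \<in> ?H" using A.m_closed[OF g(1) k(1)] by blast
  qed
qed

text \<open>An automorphism that moves \<open>x\<close> within its fibre fixes the lift \<open>h\<close>, because \<open>h \<circ> g\<close> and \<open>h\<close> are
  lifts of \<open>p\<close> that agree at \<open>x\<close>.\<close>

lemma stabilizer_orbit:
  fixes X :: "'c ugraph" and Y :: "('a, 'm) ugraph_scheme" and Z :: "('b, 'n) ugraph_scheme"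
  assumes univ: "universal_covering TYPE('c) X Z p"
    and f: "covering Y Z f" and h: "covering_hom X p Y f h" and x: "x \<in> points X"
  shows "orbit_of {g \<in> carrier (covering_aut X p). \<forall>x\<in>points X. h (g x) = h x} x =
    {y \<in> points X. h y = h x}" (is "orbit_of ?H x = _")
proof (intro equalityI subsetI)
  fix y assume "y \<in> orbit_of ?H x"
  then obtain g where g: "g \<in> ?H" "y = g x" unfolding orbit_of_def by blast
  have gc: "g \<in> carrier (covering_aut X p)" using CollectD[OF g(1)] by (rule conjunct1)
  have gh: "\<forall>x\<in>points X. h (g x) = h x" using CollectD[OF g(1)] by (rule conjunct2)
  show "y \<in> {y \<in> points X. h y = h x}"
    unfolding g(2) mem_Collect_eq using covering_aut_points[OF gc x] bspec[OF gh x] by (rule conjI)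
next
  fix y assume "y \<in> {y \<in> points X. h y = h x}"
  then have y: "y \<in> points X" "h y = h x" by simp_all
  note X = universal_coveringD(2)[OF univ]
  have P: "profinite_graph X" using X by (simp add: connected_profinite_graph_def)
  note gr = profinite_is_graph[OF P]
  obtain I :: "(nat + 'a + 'b) set" and rel and G :: "_ \<Rightarrow> nat graph" and D :: "_ \<Rightarrow> nat graph"
    and \<phi> \<psi> F a b where "covering_system Y Z I rel G \<phi> a D \<psi> b f F"
    using coveringE[OF f] .
  then interpret C: covering_system Y Z I rel G \<phi> a D \<psi> b f F .
  have hcont: "cont_graph_map X Y h" and hmap: "graph_map X Y h"
    and fh: "\<And>x. x \<in> points X \<Longrightarrow> f (h x) = p x"
    using h by (simp_all add: covering_hom_def cont_graph_map_def)
  have "p x = p y" using fh[OF x] fh[OF y(1)] y(2) by simp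
  from universal_covering_transitive[OF univ x y(1) this]
  obtain g where g: "g \<in> carrier (covering_aut X p)" "g x = y" by (elim bexE)
  note gmap = covering_aut_map[OF g(1)]
  \<comment> \<open>Uniqueness of lifts starts at a vertex, so for an edge the agreement is moved to
    its source.\<close>
  have "\<exists>c\<in>verts X. h (g c) = h c"
  proof (cases "x \<in> verts X")
    case True
    then show ?thesis using g(2) y(2) by blast
  next
    case False
    with x have e: "x \<in> edges X" by (simp add: points_def)
    have "h (g (src X x)) = src Y (h (g x))"
      using graph_map_src[OF gmap e] graph_map_src[OF hmap graph_map_edges[OF gmap e]] by simp
    also have "\<dots> = src Y (h x)" using g(2) y(2) by simp
    also have "\<dots> = h (src X x)" using graph_map_src[OF hmap e] by simp
    finally show ?thesis using graph_src[OF gr e] by blast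
  qed
  then obtain c where c: "c \<in> verts X" "h (g c) = h c" by blast
  have "(h \<circ> g) z = h z" if z: "z \<in> points X" for z
  proof (rule C.unique_lift[OF X cont_graph_map_compose[OF covering_aut_cont[OF g(1)] hcont] hcont
        _ c(1) _ z])
    show "f ((h \<circ> g) w) = f (h w)" if "w \<in> points X" for w
      using fh[OF covering_aut_points[OF g(1) that]] covering_aut_proj[OF g(1) that] fh[OF that] by simp
    show "(h \<circ> g) c = h c" using c(2) by simp
  qed
  then have "g \<in> ?H" using g(1) by simp
  then show "y \<in> orbit_of ?H x" using g(2) unfolding orbit_of_def by blast
qed

section \<open>The orbit graph as a copy of the covering\<close>

text \<open>Equivariance is asked at the single point \<open>x\<close>, because graph maps commute
  with \<open>src\<close>, \<open>tgt\<close> and \<open>rev_edge\<close> on edges only.\<close>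

lemma orbit_of_equivariant:
  assumes "\<And>g. g \<in> H \<Longrightarrow> s (g x) = g (s x)"
  shows "s ` orbit_of H x = orbit_of H (s x)"
proof -
  have "orbit_of H y = (\<lambda>g. g y) ` H" for y unfolding orbit_of_def by blast
  then show ?thesis by (simp add: image_image assms)
qed

theorem theorem36:
  fixes \<Gamma> :: "'a ugraph" and \<Delta> :: "'b ugraph" and \<Delta>\<^sub>u :: "'c ugraph"
    and f :: "'a \<Rightarrow> 'b" and p :: "'c \<Rightarrow> 'b"
  assumes "connected_profinite_graph \<Gamma>" and "connected_profinite_graph \<Delta>"
    and "covering \<Gamma> \<Delta> f"
    and "universal_covering TYPE('a) \<Delta>\<^sub>u \<Delta> p"
    and "universal_covering TYPE('c) \<Delta>\<^sub>u \<Delta> p"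
  shows "\<exists>H Q g. subgroup H (covering_aut \<Delta>\<^sub>u p) \<and> closedin (aut_topology \<Delta>\<^sub>u p) H \<and>
    is_profinite_orbit_graph \<Delta>\<^sub>u H Q \<and> profinite_graph_iso \<Gamma> Q g"
proof -
  \<comment> \<open>Universality at type \<open>'c\<close> governs the automorphisms of
    \<open>\<Delta>\<^sub>u\<close>; universality at type \<open>'a\<close> is applied once, to
    obtain the lift to \<Gamma>.\<close>
  note \<Gamma> = assms(1) and f = assms(3) and univ = assms(5)
  note X = universal_coveringD(2)[OF univ] and p = universal_coveringD(3)[OF univ]
  have P: "profinite_graph \<Delta>\<^sub>u" using X by (simp add: connected_profinite_graph_def)
  have P\<Gamma>: "profinite_graph \<Gamma>" using \<Gamma> by (simp add: connected_profinite_graph_def)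
  have gr\<Delta>: "is_graph \<Delta>"
    using assms(2) by (simp add: connected_profinite_graph_def profinite_is_graph)
  note gr = profinite_is_graph[OF P] and gr\<Gamma> = profinite_is_graph[OF P\<Gamma>]
  have fmap: "graph_map \<Gamma> \<Delta> f" using f by (simp add: covering_def cont_graph_map_def)
  obtain a where a: "a \<in> verts \<Gamma>" using connected_profinite_has_vert[OF \<Gamma>] .
  obtain c0 where c0: "c0 \<in> verts \<Delta>\<^sub>u" using connected_profinite_has_vert[OF X] .
  \<comment> \<open>The universal property asks for a vertex over \<open>f a\<close>, which exists
    because \<open>p\<close> is onto on vertices.\<close>
  obtain c where c: "c \<in> verts \<Delta>\<^sub>u" "p c = f a"
  proof -
    obtain I :: "(nat + 'c + 'b) set" and rel and G :: "_ \<Rightarrow> nat graph" and D :: "_ \<Rightarrow> nat graph"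
      and \<phi> \<psi> F a' b where "covering_system \<Delta>\<^sub>u \<Delta> I rel G \<phi> a' D \<psi> b p F"
      using coveringE[OF p] .
    then interpret covering_system \<Delta>\<^sub>u \<Delta> I rel G \<phi> a' D \<psi> b p F .
    show thesis
      using cover_surj_verts[OF assms(2) c0 graph_map_verts[OF fmap a]] that by blast
  qed
  obtain h where h: "covering_hom \<Delta>\<^sub>u p \<Gamma> f h"
    using universal_covering_lift[OF assms(4) f \<Gamma> c(1) a c(2)] .
  have hmap: "graph_map \<Delta>\<^sub>u \<Gamma> h" and hcont: "continuous_map (graph_topology \<Delta>\<^sub>u) (graph_topology \<Gamma>) h"
    using h by (simp_all add: covering_hom_def cont_graph_map_def)
  have surj: "h ` points \<Delta>\<^sub>u = points \<Gamma>" by (rule universal_covering_lift_surj[OF univ \<Gamma> f h])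
  have surj_verts: "h ` verts \<Delta>\<^sub>u = verts \<Gamma>"
  proof (intro equalityI subsetI)
    fix y assume y: "y \<in> verts \<Gamma>"
    then have "y \<in> h ` points \<Delta>\<^sub>u" unfolding surj by (simp add: points_def)
    then obtain x where x: "x \<in> points \<Delta>\<^sub>u" "y = h x" by blast
    then have "x \<in> verts \<Delta>\<^sub>u" using graph_map_reflects_verts[OF hmap gr\<Gamma> x(1)] y by simp
    with x(2) show "y \<in> h ` verts \<Delta>\<^sub>u" by blast
  qed (use graph_map_verts[OF hmap] in blast)
  have surj_edges: "h ` edges \<Delta>\<^sub>u = edges \<Gamma>"
  proof (intro equalityI subsetI)
    fix y assume y: "y \<in> edges \<Gamma>"
    then have "y \<in> h ` points \<Delta>\<^sub>u" unfolding surj by (simp add: points_def)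
    then obtain x where x: "x \<in> points \<Delta>\<^sub>u" "y = h x" by blast
    then have "x \<in> edges \<Delta>\<^sub>u" using graph_map_reflects_edges[OF hmap gr\<Gamma> x(1)] y by simp
    with x(2) show "y \<in> h ` edges \<Delta>\<^sub>u" by blast
  qed (use graph_map_edges[OF hmap] in blast)
  define H where "H = {g \<in> carrier (covering_aut \<Delta>\<^sub>u p). \<forall>x\<in>points \<Delta>\<^sub>u. h (g x) = h x}"
  \<comment> \<open>The candidate for the isomorphism: it names a point of \<Gamma> by its fibre
    under \<open>h\<close>, which is an orbit of \<open>H\<close>.\<close>
  define k where "k z = {x \<in> points \<Delta>\<^sub>u. h x = z}" for z
  have orbit: "orbit_of H x = k (h x)" if "x \<in> points \<Delta>\<^sub>u" for x
    unfolding H_def k_def by (rule stabilizer_orbit[OF univ f h that])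
  \<comment> \<open>Fibres are nonempty since \<open>h\<close> is onto, so different points have
    different fibres.\<close>
  have inj: "inj_on k (points \<Gamma>)"
  proof (rule inj_onI)
    fix y z assume "y \<in> points \<Gamma>" "z \<in> points \<Gamma>" and eq: "k y = k z"
    then obtain x where "x \<in> points \<Delta>\<^sub>u" "y = h x" using surj by blast
    then have "x \<in> k y" by (simp add: k_def)
    then have "x \<in> k z" using eq by simp
    then show "y = z" using \<open>y = h x\<close> by (simp add: k_def)
  qed
  define W where "W = {W. W \<subseteq> k ` points \<Gamma> \<times> k ` points \<Gamma> \<and>
    {(x, y) \<in> points \<Gamma> \<times> points \<Gamma>. (k x, k y) \<in> W} \<in> entourages \<Gamma>}"
  \<comment> \<open>The graph part is literally the orbit graph, while the entourages are those of
    \<Gamma> carried along \<open>k\<close>; the following facts show that the two descriptions fit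
    together.\<close>
  define Q :: "'c set ugraph" where "Q = \<lparr>verts = orbit_of H ` verts \<Delta>\<^sub>u, edges = orbit_of H ` edges \<Delta>\<^sub>u,
    src = image (src \<Delta>\<^sub>u), tgt = image (tgt \<Delta>\<^sub>u), rev_edge = image (rev_edge \<Delta>\<^sub>u), entourages = W\<rparr>"
  have trunc: "graph.truncate Q = orbit_graph \<Delta>\<^sub>u H"
    by (simp add: Q_def orbit_graph_def graph.truncate_def)
  have vQ: "verts Q = k ` verts \<Gamma>"
    using orbit unfolding Q_def surj_verts[symmetric] by (auto simp: points_def image_image)
  have eQ: "edges Q = k ` edges \<Gamma>"
    using orbit unfolding Q_def surj_edges[symmetric] by (auto simp: points_def image_image)
  have pQ: "points Q = k ` points \<Gamma>" unfolding points_def vQ eQ by blast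
  have maps: "src Q (k e) = k (src \<Gamma> e) \<and> tgt Q (k e) = k (tgt \<Gamma> e) \<and> rev_edge Q (k e) = k (rev_edge \<Gamma> e)"
    if e: "e \<in> edges \<Gamma>" for e
  proof -
    obtain d where d: "d \<in> edges \<Delta>\<^sub>u" "e = h d" using e unfolding surj_edges[symmetric] by blast
    have pts: "d \<in> points \<Delta>\<^sub>u" "src \<Delta>\<^sub>u d \<in> points \<Delta>\<^sub>u" "tgt \<Delta>\<^sub>u d \<in> points \<Delta>\<^sub>u" "rev_edge \<Delta>\<^sub>u d \<in> points \<Delta>\<^sub>u"
      using d(1) graph_src[OF gr d(1)] graph_tgt[OF gr d(1)] graph_rev[OF gr d(1)]
      by (simp_all add: points_def)
    have g: "graph_map \<Delta>\<^sub>u \<Delta>\<^sub>u g" if "g \<in> H" for g using that covering_aut_map unfolding H_def by blast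
    have "src \<Delta>\<^sub>u ` orbit_of H d = orbit_of H (src \<Delta>\<^sub>u d)"
      by (rule orbit_of_equivariant) (simp add: graph_map_src[OF g d(1)])
    moreover have "tgt \<Delta>\<^sub>u ` orbit_of H d = orbit_of H (tgt \<Delta>\<^sub>u d)"
      by (rule orbit_of_equivariant) (simp add: graph_map_tgt[OF g d(1)])
    moreover have "rev_edge \<Delta>\<^sub>u ` orbit_of H d = orbit_of H (rev_edge \<Delta>\<^sub>u d)"
      by (rule orbit_of_equivariant) (simp add: graph_map_rev[OF g d(1)])
    ultimately show ?thesis
      unfolding orbit[OF pts(1)] orbit[OF pts(2)] orbit[OF pts(3)] orbit[OF pts(4)]
      by (simp add: Q_def d(2) graph_map_src[OF hmap d(1)] graph_map_tgt[OF hmap d(1)]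
        graph_map_rev[OF hmap d(1)])
  qed
  have iso: "profinite_graph_iso \<Gamma> Q k"
  proof (rule profinite_graph_transport[OF P\<Gamma> inj vQ eQ maps])
    show "entourages Q = {W. W \<subseteq> points Q \<times> points Q \<and>
      {(x, y) \<in> points \<Gamma> \<times> points \<Gamma>. (k x, k y) \<in> W} \<in> entourages \<Gamma>}"
      unfolding pQ W_def[symmetric] by (simp add: Q_def)
  qed
  \<comment> \<open>Compactness enters again: \<open>h\<close> is a quotient map and
    \<open>k\<close> a homeomorphism, and \<open>k \<circ> h\<close> is the orbit map. So the
    uniformity taken from \<Gamma> induces the quotient topology.\<close>
  have "quotient_map (graph_topology \<Delta>\<^sub>u) (graph_topology \<Gamma>) h"
    by (rule T1_Spaces.continuous_imp_quotient_map[OF hcont profinite_compact[OF P]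
      profinite_Hausdorff[OF P\<Gamma>]])
      (simp add: profinite_topspace[OF P] profinite_topspace[OF P\<Gamma>] surj)
  moreover have "quotient_map (graph_topology \<Gamma>) (graph_topology Q) k"
    using iso unfolding profinite_graph_iso_def homeomorphic_map_def by blast
  ultimately have "quotient_map (graph_topology \<Delta>\<^sub>u) (graph_topology Q) (k \<circ> h)"
    by (rule quotient_map_compose)
  then have "quotient_map (graph_topology \<Delta>\<^sub>u) (graph_topology Q) (orbit_of H)"
    by (rule quotient_map_eq) (simp add: profinite_topspace[OF P] orbit)
  then have "is_profinite_orbit_graph \<Delta>\<^sub>u H Q"
    using trunc iso by (simp add: is_profinite_orbit_graph_def profinite_graph_iso_def)
  moreover have "subgroup H (covering_aut \<Delta>\<^sub>u p)"
    unfolding H_def by (rule stabilizer_subgroup[OF P])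
  moreover have "closedin (aut_topology \<Delta>\<^sub>u p) H"
    unfolding H_def by (rule stabilizer_closed[OF X f h])
  ultimately show ?thesis using iso by blast
qed

end
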